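(* Let $L=\mathbb{Q}(\sqrt m,\sqrt n)$ be a biquadratic extension of $\mathbb{Q}$ with $m,n$ square-free, $m\equiv3\pmod 4$ and $n\equiv2\pmod 4$. Let $d=\gcd(m,n)$, $k=\frac{mn}{d^2}$, and let $H_1,H_2,H_3$ be the non-classical Hopf-Galois structures on $L/\mathbb{Q}$ corresponding to $\sqrt m,\sqrt n,\sqrt k$ respectively. For $i\in\{1,2,3\}$, $\mathcal{O}_L$ is $\mathfrak{A}_{H_i}$-free if and only if there exist integers $x,y\in\mathbb{Z}$ such that at least one of the following two equations (one for each sign) is satisfied: 1. $x^2+my^2=\pm4d$, if $i=1$. 2. $x^2+ny^2=\pm2d$, if $i=2$. 3. $x^2+ky^2=\pm2\frac nd$, if $i=3$. If that is the case, then a free generator of $\mathcal{O}_L$ as $\mathfrak{A}_{H_i}$-module is $$\beta=\begin{cases}\gamma_1+\gamma_2+\frac{x-dy}{2d}\,\gamma_3+y\,\gamma_4 & \text{if } i=1,\\ \gamma_1+\frac{x}{2d}\,\gamma_2+\frac{1-y}{2}\,\gamma_3+y\,\gamma_4 & \text{if } i=2,\\ \gamma_1+\frac y2\,\gamma_2+\frac{xd-n}{2n}\,\gamma_3+\gamma_4 & \text{if } i=3,\end{cases}$$ where $\gamma_1=1,\ \gamma_2=\sqrt m,\ \gamma_3=\sqrt n,\ \gamma_4=\frac{\sqrt n+\sqrt k}{2}$.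
   Context: $L=\mathbb{Q}(\sqrt m,\sqrt n)$ has Galois group $C_2\times C_2$; its quadratic subfields are $\mathbb{Q}(\sqrt m),\mathbb{Q}(\sqrt n),\mathbb{Q}(\sqrt k)$, with $\sqrt k=\sqrt m\sqrt n/d$ and $d=\gcd(m,n)>0$. Here $k\equiv 2\pmod 4$ and $\{\gamma_1,\gamma_2,\gamma_3,\gamma_4\}$ is an integral basis of $L$. A Hopf-Galois structure on $L/\mathbb{Q}$ is a finite-dimensional cocommutative $\mathbb{Q}$-Hopf algebra $H$ with an action making $L$ a left $H$-module algebra such that $L\otimes_{\mathbb{Q}} H\to\mathrm{End}_{\mathbb{Q}}(L)$, $x\otimes h\mapsto(y\mapsto x(h\cdot y))$ is bijective. Besides the classical one $\mathbb{Q}[\mathrm{Gal}(L/\mathbb{Q})]$, there are exactly three, one for each $\zeta\in\{\sqrt m,\sqrt n,\sqrt k\}$. Explicitly, let $\tau$ generate $\mathrm{Gal}(L/\mathbb{Q}(\zeta))$ and let $\sigma\in\mathrm{Gal}(L/\mathbb{Q})\setminus\langle\tau\rangle$; since the action is faithful, the structure corresponding to $\zeta$ is identified, as an algebra acting on $L$, with the subalgebra of $\mathrm{End}_{\mathbb{Q}}(L)$ having $\mathbb{Q}$-basis $\mathrm{id},\ \tau,\ \sigma+\sigma\tau,\ \zeta(\sigma-\sigma\tau)$. The associated order is $\mathfrak{A}_H=\{h\in H: h\cdot\mathcal{O}_L\subseteq\mathcal{O}_L\}$; "$\mathcal{O}_L$ is $\mathfrak{A}_H$-free" means free (of rank one)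 as $\mathfrak{A}_H$-module, and a free generator is a $\beta\in\mathcal{O}_L$ such that $\mathfrak{A}_H\to\mathcal{O}_L$, $h\mapsto h\cdot\beta$, is bijective. *)

theory Defs
  imports "HOL-Number_Theory.Number_Theory" "HOL-Computational_Algebra.Computational_Algebra" "HOL-Library.FuncSet"
begin

text \<open>
  Number fields are subfields of the complex numbers.  Maps defined on such a field \<open>L\<close> are
  functions in \<open>extensional L\<close>, so that two of them are equal iff they agree on \<open>L\<close>.
\<close>

definition is_subfield :: "complex set \<Rightarrow> bool" where
  "is_subfield K \<longleftrightarrow> 0 \<in> K \<and> 1 \<in> K \<and>
     (\<forall>x\<in>K. \<forall>y\<in>K. x + y \<in> K \<and> x * y \<in> K) \<and> (\<forall>x\<in>K. - x \<in> K \<and> inverse x \<in> K)"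

text \<open>Every subfield contains \<open>\<rat>\<close>, so this is \<open>\<rat>(S)\<close>.\<close>

definition rat_adjoin :: "complex set \<Rightarrow> complex set" where
  "rat_adjoin S = is_subfield hull S"

definition ring_of_integers :: "complex set \<Rightarrow> complex set" where
  "ring_of_integers L = {x \<in> L. algebraic_int x}"

definition galois_group :: "complex set \<Rightarrow> complex set \<Rightarrow> (complex \<Rightarrow> complex) set" where
  "galois_group K L = {f \<in> extensional L. bij_betw f L L \<and>
     (\<forall>x\<in>L. \<forall>y\<in>L. f (x + y) = f x + f y \<and> f (x * y) = f x * f y) \<and> (\<forall>x\<in>K. f x = x)}"

text \<open>
  The subgroup generated by \<open>\<tau>\<close>; nonnegative powers suffice because the Galois groups
  in question are finite.
\<close>

definition cyclic_subgroup :: "complex set \<Rightarrow> (complex \<Rightarrow> complex) \<Rightarrow> (complex \<Rightarrow> complex) set" where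
  "cyclic_subgroup L \<tau> = range (\<lambda>j. restrict (\<tau> ^^ j) L)"

text \<open>
  \<open>hopf_galois_at L \<zeta> H\<close>: \<open>H\<close> is the non-classical Hopf-Galois structure on the biquadratic
  extension \<open>L\<close> of \<open>\<rat>\<close> that corresponds to \<open>\<zeta>\<close>, where the Hopf algebra, which acts faithfully,
  is identified with its image in the \<open>\<rat>\<close>-linear endomorphisms of \<open>L\<close>: the \<open>\<rat>\<close>-span of
  \<open>id\<close>, \<open>\<tau>\<close>, \<open>\<sigma> + \<sigma>\<tau>\<close> and \<open>\<zeta>(\<sigma> - \<sigma>\<tau>)\<close>, with \<open>\<tau>\<close> a generator of \<open>Gal(L/\<rat>(\<zeta>))\<close> and
  \<open>\<sigma> \<in> Gal(L/\<rat>)\<close> outside \<open>\<langle>\<tau>\<rangle>\<close>.  The span does not depend on the choice of \<open>\<sigma>\<close>: replacing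
  \<open>\<sigma>\<close> by \<open>\<sigma>\<tau>\<close> only changes the sign of the last basis element.
\<close>

definition hopf_galois_at :: "complex set \<Rightarrow> complex \<Rightarrow> (complex \<Rightarrow> complex) set \<Rightarrow> bool" where
  "hopf_galois_at L \<zeta> H \<longleftrightarrow> (\<exists>\<tau> \<sigma>.
     \<tau> \<in> galois_group (rat_adjoin {\<zeta>}) L \<and>
     cyclic_subgroup L \<tau> = galois_group (rat_adjoin {\<zeta>}) L \<and>
     \<sigma> \<in> galois_group \<rat> L - cyclic_subgroup L \<tau> \<and>
     H = {\<lambda>x\<in>L. of_rat a * x + of_rat b * \<tau> x + of_rat c * (\<sigma> x + \<sigma> (\<tau> x))
                 + of_rat e * (\<zeta> * (\<sigma> x - \<sigma> (\<tau> x))) | a b c e. True})"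

definition associated_order ::
    "complex set \<Rightarrow> (complex \<Rightarrow> complex) set \<Rightarrow> (complex \<Rightarrow> complex) set" where
  "associated_order L H = {h \<in> H. h ` ring_of_integers L \<subseteq> ring_of_integers L}"

definition free_generator :: "complex set \<Rightarrow> (complex \<Rightarrow> complex) set \<Rightarrow> complex \<Rightarrow> bool" where
  "free_generator L H \<beta> \<longleftrightarrow> \<beta> \<in> ring_of_integers L \<and>
     bij_betw (\<lambda>h. h \<beta>) (associated_order L H) (ring_of_integers L)"

text \<open>Freeness of rank one of the ring of integers over the associated order.\<close>

definition integers_free :: "complex set \<Rightarrow> (complex \<Rightarrow> complex) set \<Rightarrow> bool" where
  "integers_free L H \<longleftrightarrow> (\<exists>\<beta>. free_generator L H \<beta>)"

end

theory Submission
  imports Defs "Jordan_Normal_Form.Char_Poly"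
begin

text \<open>
  Write \<open>m = d m'\<close>, \<open>n = 2 d g\<close>, \<open>k = 2 m' g\<close> with \<open>d + m' = 4 f\<close>.  In a basis
  \<open>1, \<zeta>, \<xi>, \<eta>\<close> of \<open>L\<close> with \<open>\<zeta> \<xi> = s \<eta>\<close> and \<open>\<zeta> \<eta> = t \<xi>\<close>, the Hopf-Galois structure at \<open>\<zeta>\<close> consists
  of all rational maps that scale \<open>1\<close> and \<open>\<zeta>\<close> independently and act on the span of \<open>\<xi>, \<eta>\<close> as
  \<open>p + q J\<close>, where \<open>J \<xi> = s \<eta>\<close>, \<open>J \<eta> = - t \<xi>\<close>, so that \<open>J\<^sup>2 = - \<zeta>\<^sup>2\<close>.
  Testing such a map on the integral basis gives an explicit parametrisation of the associated order
  by \<open>\<int>\<^sup>4\<close>, and \<open>h \<mapsto> h \<beta>\<close> becomes an integer \<open>4 \<times> 4\<close> matrix.  Its determinant splits into linear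
  factors, which can be made units freely, and one \<open>2 \<times> 2\<close> block whose determinant is, up to a
  constant, the norm \<open>x\<^sup>2 + \<zeta>\<^sup>2 y\<^sup>2\<close> of \<open>x + y J\<close>; requiring this block to be unimodular is the stated equation.
\<close>

section \<open>Sums and products of algebraic integers\<close>

text \<open>Finitely generated additive subgroups of the complex numbers, as spans over the
  integers, serve to test integrality.\<close>

interpretation int_module: Modules.module "\<lambda>(c::int) (x::complex). of_int c * x"
  by unfold_locales (simp_all add: algebra_simps)

abbreviation int_span :: "complex set \<Rightarrow> complex set" where
  "int_span \<equiv> int_module.span"

text \<open>The values of \<open>v\<close> form an eigenvector of the integer matrix
  \<open>M\<close>, so \<open>y\<close> is a root of its characteristic polynomial, which is monic
  with integer coefficients.\<close>

lemma algebraic_int_if_int_eigenvector: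
  fixes M :: "nat \<Rightarrow> nat \<Rightarrow> int" and v :: "nat \<Rightarrow> complex"
  assumes "\<And>i. i < n \<Longrightarrow> y * v i = (\<Sum>j<n. of_int (M i j) * v j)"
    and "i0 < n" "v i0 \<noteq> 0"
  shows "algebraic_int y"
proof -
  define A where "A = mat n n (\<lambda>(i, j). M i j)"
  define B :: "complex mat" where "B = map_mat of_int A"
  have A: "A \<in> carrier_mat n n" and B: "B \<in> carrier_mat n n"
    by (auto simp: A_def B_def)
  have "eigenvector B (vec n v) y"
    unfolding eigenvector_def
  proof (intro conjI)
    show "vec n v \<in> carrier_vec (dim_row B)"
      using B by auto
    show "vec n v \<noteq> 0\<^sub>v (dim_row B)"
      using assms(2,3) B by (auto simp: vec_eq_iff)
    show "B *\<^sub>v vec n v = y \<cdot>\<^sub>v vec n v"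
      using assms(1)
      by (intro eq_vecI) (auto simp: B_def A_def scalar_prod_def lessThan_atLeast0)
  qed
  then have "poly (char_poly B) y = 0"
    using eigenvalue_root_char_poly[OF B] by (auto simp: eigenvalue_def)
  moreover have "char_poly B = map_poly of_int (char_poly A)"
    unfolding B_def by (rule of_int_hom.char_poly_hom[OF A])
  moreover have "lead_coeff (char_poly A) = 1"
    using degree_monic_char_poly[OF A] by simp
  ultimately show ?thesis
    unfolding algebraic_int_altdef_ipoly by auto
qed

text \<open>Enumerating \<open>V\<close> turns the stability into an integer matrix with eigenvalue
  \<open>y\<close>; the element \<open>v0\<close> keeps the eigenvector from vanishing.\<close>

lemma algebraic_int_if_stable_int_span:
  assumes "finite V" "v0 \<in> V" "v0 \<noteq> 0" and "\<And>v. v \<in> V \<Longrightarrow> y * v \<in> int_span V"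
  shows "algebraic_int y"
proof -
  define n where "n = card V"
  obtain v where v: "bij_betw v {..<n} V"
    using ex_bij_betw_nat_finite[OF \<open>finite V\<close>] unfolding n_def lessThan_atLeast0 by blast
  have "\<exists>c. y * v i = (\<Sum>j<n. of_int (c j) * v j)" if "i < n" for i
  proof -
    have "v i \<in> V"
      using v that by (auto simp: bij_betw_def)
    then obtain u :: "complex \<Rightarrow> int" where "y * v i = (\<Sum>x\<in>V. of_int (u x) * x)"
      using assms(4) int_module.span_finite[OF \<open>finite V\<close>] by blast
    also have "\<dots> = (\<Sum>j<n. of_int (u (v j)) * v j)"
      using sum.reindex_bij_betw[OF v, of "\<lambda>x. of_int (u x) * x"] by simp
    finally show ?thesis
      by (intro exI[of _ "u \<circ> v"]) simp
  qed
  then obtain M where "\<And>i. i < n \<Longrightarrow> y * v i = (\<Sum>j<n. of_int (M i j) * v j)"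
    by metis
  moreover obtain i0 where "i0 < n" "v i0 = v0"
    using v \<open>v0 \<in> V\<close> by (auto simp: bij_betw_def)
  ultimately show ?thesis
    using algebraic_int_if_int_eigenvector \<open>v0 \<noteq> 0\<close> by blast
qed

lemma int_span_mult_closed:
  assumes "\<And>v. v \<in> V \<Longrightarrow> a * v \<in> int_span V" and "x \<in> int_span V"
  shows "a * x \<in> int_span V"
  using assms(2)
proof (induction rule: int_module.span_induct_alt)
  case base
  then show ?case by (simp add: int_module.span_zero)
next
  case (step c x y)
  have "a * (of_int c * x + y) = of_int c * (a * x) + a * y"
    by (simp add: algebra_simps)
  then show ?case
    using step assms(1) by (simp add: int_module.span_add int_module.span_scale)
qed

lemma algebraic_int_power_eq:
  fixes x :: complex
  assumes "algebraic_int x"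
  obtains p and c :: "nat \<Rightarrow> int" where "0 < p" "x ^ p = (\<Sum>i<p. of_int (c i) * x ^ i)"
proof -
  obtain P :: "int poly" where P: "poly (map_poly of_int P) x = 0" "lead_coeff P = 1"
    using assms unfolding algebraic_int_altdef_ipoly by auto
  have deg: "degree P > 0"
  proof (rule ccontr)
    assume "\<not> degree P > 0"
    then have "P = 1"
      using P(2) by (metis degree_0_id gr0I one_pCons)
    then show False using P(1) by simp
  qed
  have "0 = (\<Sum>i\<le>degree P. of_int (coeff P i) * x ^ i)"
    using P(1) by (simp add: poly_altdef)
  also have "\<dots> = x ^ degree P + (\<Sum>i<degree P. of_int (coeff P i) * x ^ i)"
    using P(2) by (simp add: lessThan_Suc_atMost[symmetric])
  finally have "x ^ degree P = (\<Sum>i<degree P. of_int (- coeff P i) * x ^ i)"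
    by (simp add: sum_negf eq_neg_iff_add_eq_0)
  with deg show ?thesis by (rule that)
qed

text \<open>The monomials \<open>x ^ i * y ^ j\<close> with \<open>i < p\<close> and
  \<open>j < q\<close> suffice, because the monic equations reduce \<open>x ^ p\<close> and
  \<open>y ^ q\<close>. One such \<open>V\<close> serves both the sum and the product.\<close>

lemma algebraic_int_common_int_span:
  fixes x y :: complex
  assumes "algebraic_int x" "algebraic_int y"
  obtains V where "finite V" "1 \<in> V"
    "\<And>z. z \<in> int_span V \<Longrightarrow> x * z \<in> int_span V" "\<And>z. z \<in> int_span V \<Longrightarrow> y * z \<in> int_span V"
proof -
  obtain p c where p: "0 < p" "x ^ p = (\<Sum>i<p. of_int (c i) * x ^ i)"
    using algebraic_int_power_eq[OF assms(1)] by blast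
  obtain q e where q: "0 < q" "y ^ q = (\<Sum>i<q. of_int (e i) * y ^ i)"
    using algebraic_int_power_eq[OF assms(2)] by blast
  define V where "V = (\<lambda>(i, j). x ^ i * y ^ j) ` ({..<p} \<times> {..<q})"
  have mem: "x ^ i * y ^ j \<in> int_span V" if "i < p" "j < q" for i j
    using that by (auto simp: V_def intro!: int_module.span_base)
  have x: "x * v \<in> int_span V" if "v \<in> V" for v
  proof -
    obtain i j where v: "v = x ^ i * y ^ j" "i < p" "j < q"
      using \<open>v \<in> V\<close> by (auto simp: V_def)
    show ?thesis
    proof (cases "Suc i < p")
      case True
      then show ?thesis using mem[of "Suc i" j] v by (simp add: mult.assoc)
    next
      case False
      then have "p = Suc i" using v by simp
      then have "x * v = x ^ p * y ^ j" using v by simp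
      also have "\<dots> = (\<Sum>i<p. of_int (c i) * (x ^ i * y ^ j))"
        unfolding p(2) by (simp add: sum_distrib_right mult.assoc)
      also have "\<dots> \<in> int_span V"
        using mem v by (intro int_module.span_sum int_module.span_scale) auto
      finally show ?thesis .
    qed
  qed
  have y: "y * v \<in> int_span V" if "v \<in> V" for v
  proof -
    obtain i j where v: "v = x ^ i * y ^ j" "i < p" "j < q"
      using \<open>v \<in> V\<close> by (auto simp: V_def)
    show ?thesis
    proof (cases "Suc j < q")
      case True
      then show ?thesis using mem[of i "Suc j"] v by (simp add: algebra_simps)
    next
      case False
      then have "q = Suc j" using v by simp
      then have "y * v = y ^ q * x ^ i" using v by simp
      also have "\<dots> = (\<Sum>j<q. of_int (e j) * (x ^ i * y ^ j))"
        unfolding q(2) by (simp add: sum_distrib_left mult_ac)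
      also have "\<dots> \<in> int_span V"
        using mem v by (intro int_module.span_sum int_module.span_scale) auto
      finally show ?thesis .
    qed
  qed
  show ?thesis
  proof (rule that[of V])
    show "finite V" by (simp add: V_def)
    show "1 \<in> V" using p(1) q(1) by (force simp: V_def)
  qed (use x y int_span_mult_closed in blast)+
qed

lemma algebraic_int_add:
  fixes x y :: complex
  assumes "algebraic_int x" "algebraic_int y"
  shows "algebraic_int (x + y)"
proof -
  obtain V where "finite V" "1 \<in> V"
    "\<And>z. z \<in> int_span V \<Longrightarrow> x * z \<in> int_span V" "\<And>z. z \<in> int_span V \<Longrightarrow> y * z \<in> int_span V"
    using algebraic_int_common_int_span[OF assms] by blast
  then show ?thesis
    by (intro algebraic_int_if_stable_int_span[of V 1])
      (auto simp: distrib_right intro: int_module.span_add int_module.span_base)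
qed

lemma algebraic_int_mult:
  fixes x y :: complex
  assumes "algebraic_int x" "algebraic_int y"
  shows "algebraic_int (x * y)"
proof -
  obtain V where "finite V" "1 \<in> V"
    "\<And>z. z \<in> int_span V \<Longrightarrow> x * z \<in> int_span V" "\<And>z. z \<in> int_span V \<Longrightarrow> y * z \<in> int_span V"
    using algebraic_int_common_int_span[OF assms] by blast
  then show ?thesis
    by (intro algebraic_int_if_stable_int_span[of V 1])
      (auto simp: mult.assoc intro: int_module.span_base)
qed

section \<open>Biquadratic extensions and their Hopf-Galois structures\<close>

lemma is_subfield_rat_adjoin: "is_subfield (rat_adjoin S)"
  unfolding rat_adjoin_def by (rule hull_in) (auto simp: is_subfield_def)

lemma subset_rat_adjoin: "S \<subseteq> rat_adjoin S"
  unfolding rat_adjoin_def by (rule hull_subset)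

lemma rat_adjoin_minimal: "S \<subseteq> K \<Longrightarrow> is_subfield K \<Longrightarrow> rat_adjoin S \<subseteq> K"
  unfolding rat_adjoin_def by (rule hull_minimal)

lemma is_subfield_of_rat:
  assumes K: "is_subfield K"
  shows "of_rat r \<in> K"
proof -
  have nat: "of_nat n \<in> K" for n
    by (induction n) (use K in \<open>auto simp: is_subfield_def\<close>)
  have int: "of_int i \<in> K" for i
    by (cases i rule: int_diff_cases)
      (metis K nat diff_conv_add_uminus is_subfield_def of_int_diff of_int_of_nat_eq)
  obtain a b where "r = of_int a / of_int b"
    by (metis Fract_of_int_quotient quotient_of_div surj_pair)
  then have "of_rat r = (of_int a :: complex) * inverse (of_int b)"
    by (simp add: of_rat_divide) (simp add: divide_inverse)
  then show ?thesis
    using K int by (simp add: is_subfield_def)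
qed

lemma Rats_subset_subfield: "is_subfield K \<Longrightarrow> \<rat> \<subseteq> K"
  using is_subfield_of_rat by (auto elim: Rats_cases)

lemma galois_groupD:
  assumes "f \<in> galois_group K L"
  shows "f \<in> extensional L" "bij_betw f L L"
    "\<And>x y. x \<in> L \<Longrightarrow> y \<in> L \<Longrightarrow> f (x + y) = f x + f y"
    "\<And>x y. x \<in> L \<Longrightarrow> y \<in> L \<Longrightarrow> f (x * y) = f x * f y"
    "\<And>x. x \<in> K \<Longrightarrow> f x = x" "\<And>x. x \<in> L \<Longrightarrow> f x \<in> L"
  using assms bij_betw_apply[of f L L] by (auto simp: galois_group_def)

lemma galois_group_antimono: "K \<subseteq> K' \<Longrightarrow> galois_group K' L \<subseteq> galois_group K L"
  by (auto simp: galois_group_def)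

text \<open>By minimality of \<open>rat_adjoin\<close>, this lets an automorphism that fixes
  generators fix all that they generate. Negatives are treated as multiples of the rational number
  -1.\<close>

lemma is_subfield_fixed_field:
  assumes f: "f \<in> galois_group \<rat> L" and L: "is_subfield L"
  shows "is_subfield {x \<in> L. f x = x}"
proof -
  note f = galois_groupD[OF f]
  have neg: "f (- x) = - x" if "x \<in> L" "f x = x" for x
  proof -
    have "f (- 1 * x) = f (- 1) * f x"
      using that is_subfield_of_rat[OF L, of "- 1"] by (intro f) auto
    then show ?thesis using that f(5)[of "- 1"] by simp
  qed
  have inv: "f (inverse x) = inverse x" if x: "x \<in> L" "f x = x" for x
  proof (cases "x = 0")
    case True
    then show ?thesis using x by simp
  next
    case False
    have "f (x * inverse x) = f x * f (inverse x)"
      using x L by (intro f) (auto simp: is_subfield_def)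
    then have "1 = x * f (inverse x)"
      using False x f(5)[of 1] by simp
    then show ?thesis by (metis inverse_unique)
  qed
  show ?thesis
    unfolding is_subfield_def using L f neg inv
    by (auto simp: is_subfield_def)
qed

lemma galois_group_rat_adjoin_iff:
  assumes L: "is_subfield L" and "S \<subseteq> L"
  shows "f \<in> galois_group (rat_adjoin S) L \<longleftrightarrow> f \<in> galois_group \<rat> L \<and> (\<forall>x\<in>S. f x = x)"
proof safe
  assume f: "f \<in> galois_group (rat_adjoin S) L"
  show "f \<in> galois_group \<rat> L"
    using f galois_group_antimono Rats_subset_subfield[OF is_subfield_rat_adjoin] by blast
  show "f x = x" if "x \<in> S" for x
    using galois_groupD(5)[OF f] subset_rat_adjoin that by blast
next
  assume f: "f \<in> galois_group \<rat> L" and fix_S: "\<forall>x\<in>S. f x = x"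
  have "rat_adjoin S \<subseteq> {x \<in> L. f x = x}"
    using fix_S \<open>S \<subseteq> L\<close> by (intro rat_adjoin_minimal is_subfield_fixed_field f L) auto
  then show "f \<in> galois_group (rat_adjoin S) L"
    using f by (auto simp: galois_group_def)
qed

text \<open>One calculation serves all three structures: \<zeta> is the root that labels the
  structure, \<xi> and \<eta> are the other two. The constants \<open>v\<close>, \<open>s\<close>,
  \<open>t\<close> determine the whole multiplication table.\<close>

locale biquadratic_basis =
  fixes \<zeta> \<xi> \<eta> :: complex and v s t :: rat
  assumes xi_sq: "\<xi> * \<xi> = of_rat v"
    and zeta_xi: "\<zeta> * \<xi> = of_rat s * \<eta>"
    and zeta_eta: "\<zeta> * \<eta> = of_rat t * \<xi>"
    and s_nonzero: "s \<noteq> 0"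
    and independent: "of_rat a + of_rat b * \<zeta> + of_rat c * \<xi> + of_rat e * \<eta> = 0 \<Longrightarrow>
      a = 0 \<and> b = 0 \<and> c = 0 \<and> e = 0"
begin

definition elt :: "rat \<Rightarrow> rat \<Rightarrow> rat \<Rightarrow> rat \<Rightarrow> complex" where
  "elt a b c e = of_rat a + of_rat b * \<zeta> + of_rat c * \<xi> + of_rat e * \<eta>"

definition field :: "complex set" where
  "field = {elt a b c e | a b c e. True}"

text \<open>Any prescription in coordinates becomes an extensional map on the field; the description
  is unambiguous because coordinates are unique.\<close>

definition linmap :: "(rat \<Rightarrow> rat \<Rightarrow> rat \<Rightarrow> rat \<Rightarrow> complex) \<Rightarrow> complex \<Rightarrow> complex" where
  "linmap F = (\<lambda>x\<in>field. THE y. \<exists>a b c e. x = elt a b c e \<and> y = F a b c e)"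

section \<open>Arithmetic in coordinates\<close>

lemma elt_eq_0_iff: "elt a b c e = 0 \<longleftrightarrow> a = 0 \<and> b = 0 \<and> c = 0 \<and> e = 0"
  using independent[of a b c e] by (auto simp: elt_def)

lemma elt_eq_iff: "elt a b c e = elt a' b' c' e' \<longleftrightarrow> a = a' \<and> b = b' \<and> c = c' \<and> e = e'"
proof -
  have "elt a b c e = elt a' b' c' e' \<longleftrightarrow> elt (a - a') (b - b') (c - c') (e - e') = 0"
    by (simp add: elt_def of_rat_diff algebra_simps)
  then show ?thesis by (simp add: elt_eq_0_iff)
qed

lemma elt_in_field [simp]: "elt a b c e \<in> field"
  by (auto simp: field_def)

lemma fieldE:
  assumes "x \<in> field"
  obtains a b c e where "x = elt a b c e"
  using assms by (auto simp: field_def)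

lemma elt_basis: "elt a 0 0 0 = of_rat a" "elt 0 1 0 0 = \<zeta>" "elt 0 0 1 0 = \<xi>" "elt 0 0 0 1 = \<eta>"
  by (simp_all add: elt_def)

lemma basis_in_field: "of_rat a \<in> field" "\<zeta> \<in> field" "\<xi> \<in> field" "\<eta> \<in> field"
  by (metis elt_basis elt_in_field)+

lemma basis_nonzero: "\<zeta> \<noteq> 0" "\<xi> \<noteq> 0" "\<eta> \<noteq> 0"
  using elt_eq_0_iff[of 0 1 0 0] elt_eq_0_iff[of 0 0 1 0] elt_eq_0_iff[of 0 0 0 1]
  by (simp_all add: elt_basis)

lemma linmap_elt [simp]: "linmap F (elt a b c e) = F a b c e"
  unfolding linmap_def by (auto simp: elt_eq_iff)

lemma linmap_extensional [simp]: "linmap F \<in> extensional field"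
  by (simp add: linmap_def)

lemma eq_linmap_iff:
  "f = linmap F \<longleftrightarrow> f \<in> extensional field \<and> (\<forall>a b c e. f (elt a b c e) = F a b c e)"
  by (auto intro!: extensionalityI[of f field "linmap F"] elim!: fieldE)

text \<open>Cancel \<xi> from \<zeta> (\<zeta> \<xi>) = s t \<xi>.\<close>

lemma zeta_sq: "\<zeta> * \<zeta> = of_rat (s * t)"
proof -
  have "\<zeta> * \<zeta> * \<xi> = of_rat (s * t) * \<xi>"
    using zeta_xi zeta_eta by (metis mult.assoc mult.commute of_rat_mult)
  then show ?thesis using basis_nonzero by simp
qed

lemma eta_eq: "\<eta> = \<zeta> * \<xi> / of_rat s"
  using zeta_xi s_nonzero by simp

lemma xi_eta: "\<xi> * \<eta> = of_rat (v / s) * \<zeta>"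
  using xi_sq by (simp add: eta_eq of_rat_divide mult_ac)

lemma eta_sq: "\<eta> * \<eta> = of_rat (v * t / s)"
proof -
  have "\<eta> * \<eta> = (\<zeta> * \<zeta>) * (\<xi> * \<xi>) / (of_rat s * of_rat s)"
    by (simp add: eta_eq)
  then show ?thesis
    using s_nonzero unfolding zeta_sq xi_sq by (simp add: of_rat_divide of_rat_mult)
qed

lemma elt_add: "elt a b c e + elt a' b' c' e' = elt (a + a') (b + b') (c + c') (e + e')"
  by (simp add: elt_def of_rat_add algebra_simps)

lemma elt_uminus: "- elt a b c e = elt (- a) (- b) (- c) (- e)"
  by (simp add: elt_def of_rat_minus algebra_simps)

lemma elt_mult:
  "elt a b c e * elt a' b' c' e' =
    elt (a * a' + b * b' * (s * t) + c * c' * v + e * e' * (v * t / s))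
      (a * b' + b * a' + (c * e' + e * c') * (v / s))
      (a * c' + c * a' + (b * e' + e * b') * t)
      (a * e' + e * a' + (b * c' + c * b') * s)"
proof -
  have "elt a b c e * elt a' b' c' e' =
      of_rat (a * a') + of_rat (a * b' + b * a') * \<zeta> + of_rat (a * c' + c * a') * \<xi> +
      of_rat (a * e' + e * a') * \<eta> + of_rat (b * b') * (\<zeta> * \<zeta>) + of_rat (c * c') * (\<xi> * \<xi>) +
      of_rat (e * e') * (\<eta> * \<eta>) + of_rat (b * c' + c * b') * (\<zeta> * \<xi>) +
      of_rat (b * e' + e * b') * (\<zeta> * \<eta>) + of_rat (c * e' + e * c') * (\<xi> * \<eta>)"
    unfolding elt_def of_rat_add of_rat_mult by (simp add: algebra_simps)
  then show ?thesis
    unfolding elt_def zeta_sq xi_sq eta_sq zeta_xi zeta_eta xi_eta of_rat_add of_rat_mult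
    by (simp add: algebra_simps)
qed

lemma elt_scale: "of_rat r * elt a b c e = elt (r * a) (r * b) (r * c) (r * e)"
  by (simp add: elt_def of_rat_mult algebra_simps)

lemma is_subfield_field: "is_subfield field"
proof -
  have inv: "inverse x \<in> field" if "x \<in> field" for x
  proof (cases "x = 0")
    case True
    then show ?thesis using basis_in_field(1)[of 0] by simp
  next
    case False
    obtain a b c e where x: "x = elt a b c e"
      using \<open>x \<in> field\<close> by (rule fieldE)
    have nz: "elt a b c e \<noteq> 0" "elt a b (- c) (- e) \<noteq> 0"
      using False x by (auto simp: elt_eq_0_iff)
    \<comment> \<open>\<open>P + Q \<zeta>\<close> is the relative norm of \<open>x\<close> to
      \<rat>(\<zeta>), and \<open>R\<close> below is the norm of that to \<rat>. Both are nonzero as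
      products of nonzero complex numbers, so the complementary factor divided by \<open>R\<close>
      inverts \<open>x\<close>.\<close>
    define P where "P = a * a + b * b * (s * t) - c * c * v - e * e * (v * t / s)"
    define Q where "Q = 2 * a * b - 2 * c * e * (v / s)"
    have 1: "elt a b c e * elt a b (- c) (- e) = elt P Q 0 0"
      by (simp add: elt_mult elt_eq_iff P_def Q_def algebra_simps)
    then have "elt P Q 0 0 \<noteq> 0"
      using nz by (metis mult_eq_0_iff)
    then have "elt P (- Q) 0 0 \<noteq> 0"
      by (simp add: elt_eq_0_iff)
    define R where "R = P * P - Q * Q * (s * t)"
    have 2: "elt P Q 0 0 * elt P (- Q) 0 0 = of_rat R"
      by (simp add: elt_mult elt_eq_iff R_def algebra_simps flip: elt_basis(1))
    have "R \<noteq> 0"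
      using 2 \<open>elt P Q 0 0 \<noteq> 0\<close> \<open>elt P (- Q) 0 0 \<noteq> 0\<close> by (metis mult_eq_0_iff of_rat_0)
    have "x * (of_rat (1 / R) * (elt a b (- c) (- e) * elt P (- Q) 0 0)) = 1"
      using 2 \<open>R \<noteq> 0\<close> unfolding x 1[symmetric] by (simp add: of_rat_divide mult_ac)
    then have "inverse x = of_rat (1 / R) * (elt a b (- c) (- e) * elt P (- Q) 0 0)"
      by (rule inverse_unique)
    then show ?thesis by (simp add: elt_mult elt_scale)
  qed
  show ?thesis
    unfolding is_subfield_def
    using basis_in_field(1)[of 0] basis_in_field(1)[of 1] inv
    by (auto simp: elt_add elt_mult elt_uminus elim!: fieldE)
qed

lemma rat_adjoin_zeta_xi: "rat_adjoin {\<zeta>, \<xi>} = field"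
proof
  show "rat_adjoin {\<zeta>, \<xi>} \<subseteq> field"
    using basis_in_field is_subfield_field by (intro rat_adjoin_minimal) auto
  have K: "is_subfield (rat_adjoin {\<zeta>, \<xi>})" and gen: "\<zeta> \<in> rat_adjoin {\<zeta>, \<xi>}" "\<xi> \<in> rat_adjoin {\<zeta>, \<xi>}"
    using is_subfield_rat_adjoin subset_rat_adjoin by blast+
  then have "\<eta> \<in> rat_adjoin {\<zeta>, \<xi>}"
    using is_subfield_of_rat[OF K] unfolding eta_eq divide_inverse is_subfield_def by blast
  then show "field \<subseteq> rat_adjoin {\<zeta>, \<xi>}"
    using K gen is_subfield_of_rat[OF K] by (auto simp: field_def elt_def is_subfield_def)
qed

text \<open>Square roots of rationals go to plus or minus themselves, and \<eta> = \<zeta> \<xi> / s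
  picks up both signs.\<close>

lemma galois_group_elt:
  assumes f: "f \<in> galois_group \<rat> field"
  obtains \<epsilon> \<delta> :: rat where "\<epsilon> = 1 \<or> \<epsilon> = - 1" "\<delta> = 1 \<or> \<delta> = - 1"
    "\<And>a b c e. f (elt a b c e) = elt a (\<epsilon> * b) (\<delta> * c) (\<epsilon> * \<delta> * e)"
proof -
  note D = galois_groupD[OF f]
  have rat: "f (of_rat r) = of_rat r" for r
    by (rule D) auto
  have "f \<zeta> * f \<zeta> = \<zeta> * \<zeta>"
    using D(4)[of \<zeta> \<zeta>] basis_in_field rat unfolding zeta_sq by simp
  then obtain \<epsilon> :: rat where \<epsilon>: "\<epsilon> = 1 \<or> \<epsilon> = - 1" "f \<zeta> = of_rat \<epsilon> * \<zeta>"
    by (metis mult_minus1 mult_1 of_rat_1 of_rat_minus square_eq_iff)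
  have "f \<xi> * f \<xi> = \<xi> * \<xi>"
    using D(4)[of \<xi> \<xi>] basis_in_field rat unfolding xi_sq by simp
  then obtain \<delta> :: rat where \<delta>: "\<delta> = 1 \<or> \<delta> = - 1" "f \<xi> = of_rat \<delta> * \<xi>"
    by (metis mult_minus1 mult_1 of_rat_1 of_rat_minus square_eq_iff)
  have "f (\<zeta> * \<xi>) = f (of_rat s * \<eta>)"
    by (simp add: zeta_xi)
  then have "of_rat \<epsilon> * of_rat \<delta> * (\<zeta> * \<xi>) = of_rat s * f \<eta>"
    using D(4) basis_in_field rat \<epsilon> \<delta> by (simp add: mult_ac)
  then have \<eta>: "f \<eta> = of_rat (\<epsilon> * \<delta>) * \<eta>"
    using s_nonzero unfolding zeta_xi by (simp add: of_rat_mult mult_ac)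
  have "f (elt a b c e) = elt a (\<epsilon> * b) (\<delta> * c) (\<epsilon> * \<delta> * e)" for a b c e
  proof -
    have mem: "of_rat r * x \<in> field" if "x \<in> field" for r x
      using that by (auto simp: elt_scale elim: fieldE)
    have add: "x + y \<in> field" if "x \<in> field" "y \<in> field" for x y
      using that is_subfield_field by (auto simp: is_subfield_def)
    show ?thesis
      unfolding elt_def
      by (simp add: D(3,4) basis_in_field mem add rat \<epsilon>(2) \<delta>(2) \<eta>)
        (simp add: of_rat_mult mult_ac)
  qed
  with \<epsilon>(1) \<delta>(1) show ?thesis by (rule that)
qed

section \<open>Conjugation over the quadratic subfield \<rat>(\<zeta>)\<close>

definition conjugation :: "complex \<Rightarrow> complex" where
  "conjugation = linmap (\<lambda>a b c e. elt a b (- c) (- e))"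

lemma conjugation_elt [simp]: "conjugation (elt a b c e) = elt a b (- c) (- e)"
  by (simp add: conjugation_def)

lemma conjugation_add:
  "x \<in> field \<Longrightarrow> y \<in> field \<Longrightarrow> conjugation (x + y) = conjugation x + conjugation y"
  by (auto simp: elt_add elim!: fieldE)

lemma conjugation_mult:
  "x \<in> field \<Longrightarrow> y \<in> field \<Longrightarrow> conjugation (x * y) = conjugation x * conjugation y"
  by (auto simp: elt_mult algebra_simps elim!: fieldE)

text \<open>This involution witnesses that the group over \<rat>(\<zeta>) is nontrivial, which later
  excludes that \<tau> is the identity.\<close>

lemma conjugation_in_galois_group: "conjugation \<in> galois_group (rat_adjoin {\<zeta>}) field"
proof -
  have "conjugation x \<in> field \<and> conjugation (conjugation x) = x" if "x \<in> field" for x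
    using that by (auto elim!: fieldE)
  then have "bij_betw conjugation field field"
    by (intro bij_betwI[where g = conjugation]) auto
  moreover have "conjugation x = x" if "x \<in> \<rat>" for x
    using that conjugation_elt[of _ 0 0 0] by (auto simp: elt_basis elim!: Rats_cases)
  moreover have "conjugation \<zeta> = \<zeta>"
    using conjugation_elt[of 0 1 0 0] by (simp add: elt_basis)
  ultimately show ?thesis
    using conjugation_add conjugation_mult basis_in_field
    by (subst galois_group_rat_adjoin_iff[OF is_subfield_field])
      (auto simp: galois_group_def conjugation_def)
qed

text \<open>Conjugation fixes rationals and respects sums and products, so it sends a root of an
  integer polynomial to a root of the same polynomial.\<close>

lemma algebraic_int_conjugation:
  assumes "x \<in> field" "algebraic_int x"
  shows "algebraic_int (conjugation x)"
proof -
  obtain p :: "int poly" where p: "poly (map_poly of_int p) x = 0" "lead_coeff p = 1"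
    using assms(2) unfolding algebraic_int_altdef_ipoly by auto
  have rat: "conjugation (of_rat r) = of_rat r" for r
    using conjugation_elt[of r 0 0 0] by (simp add: elt_basis)
  \<comment> \<open>Membership in \<open>field\<close> is carried along in the induction, since the
    laws of conjugation are available only there.\<close>
  have "conjugation (poly (map_poly of_int q) x) = poly (map_poly of_int q) (conjugation x) \<and>
      poly (map_poly of_int q) x \<in> field" for q :: "int poly"
  proof (induction q)
    case 0
    then show ?case using rat[of 0] basis_in_field(1)[of 0] by simp
  next
    case (pCons a q)
    have "of_int a \<in> field" "conjugation (of_int a) = of_int a"
      using rat[of "of_int a"] basis_in_field(1)[of "of_int a"] by simp_all
    moreover have "map_poly of_int (pCons a q) = pCons (of_int a :: complex) (map_poly of_int q)"
      using pCons.hyps by (intro map_poly_pCons) auto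
    moreover have "x * poly (map_poly of_int q) x \<in> field"
      using assms(1) pCons.IH is_subfield_field by (auto simp: is_subfield_def)
    ultimately show ?case
      using assms(1) pCons.IH is_subfield_field
      by (simp add: conjugation_add conjugation_mult) (simp add: is_subfield_def)
  qed
  then have "poly (map_poly of_int p) (conjugation x) = 0"
    using p(1) rat[of 0] by (metis of_rat_0)
  with p(2) show ?thesis
    unfolding algebraic_int_altdef_ipoly by blast
qed

text \<open>On 1, on \<zeta> and on the plane of \<xi>, \<eta>, the map \<tau> acts as 1, 1, -1, and
  \<sigma> + \<sigma>\<tau> acts as 2, -2, 0. The last basis element kills 1 and \<zeta> and acts on
  the plane as plus or minus 2 J, where J \<xi> = s \<eta> and J \<eta> = - t \<xi>. Together with
  the identity they span exactly the maps given by \<open>A\<close>, \<open>B\<close> and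
  \<open>p + q J\<close>.\<close>

lemma hopf_galois_at_iff:
  assumes "hopf_galois_at field \<zeta> H"
  shows "h \<in> H \<longleftrightarrow> h \<in> extensional field \<and> (\<exists>A B p q. \<forall>a b c e.
    h (elt a b c e) = elt (A * a) (B * b) (p * c - q * t * e) (q * s * c + p * e))"
proof -
  obtain \<tau> \<sigma> where \<tau>: "\<tau> \<in> galois_group (rat_adjoin {\<zeta>}) field"
    and cyc: "cyclic_subgroup field \<tau> = galois_group (rat_adjoin {\<zeta>}) field"
    and \<sigma>: "\<sigma> \<in> galois_group \<rat> field" "\<sigma> \<notin> galois_group (rat_adjoin {\<zeta>}) field"
    and H: "H = {\<lambda>x\<in>field. of_rat a * x + of_rat b * \<tau> x + of_rat c * (\<sigma> x + \<sigma> (\<tau> x))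
                 + of_rat e * (\<zeta> * (\<sigma> x - \<sigma> (\<tau> x))) | a b c e. True}"
    using assms unfolding hopf_galois_at_def by auto
  note gal = galois_group_rat_adjoin_iff[OF is_subfield_field, of "{\<zeta>}"]
  have \<tau>': "\<tau> \<in> galois_group \<rat> field" "\<tau> \<zeta> = \<zeta>"
    using \<tau> gal basis_in_field by auto
  obtain \<epsilon>1 \<delta>1 where t1: "\<epsilon>1 = 1 \<or> \<epsilon>1 = - 1" "\<delta>1 = 1 \<or> \<delta>1 = - 1"
    "\<And>a b c e. \<tau> (elt a b c e) = elt a (\<epsilon>1 * b) (\<delta>1 * c) (\<epsilon>1 * \<delta>1 * e)"
    by (rule galois_group_elt[OF \<tau>'(1)]) blast
  have e1: "\<epsilon>1 = 1"
    using \<tau>'(2) t1(3)[of 0 1 0 0] elt_eq_iff[of 0 \<epsilon>1 0 0 0 1 0 0] by (simp add: elt_basis)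
  \<comment> \<open>Otherwise \<tau> is the identity on the field and generates a trivial group,
    which misses \<open>conjugation\<close>.\<close>
  have d1: "\<delta>1 = - 1"
  proof (rule ccontr)
    assume "\<delta>1 \<noteq> - 1"
    then have "\<tau> x = x" if "x \<in> field" for x
      using that t1 e1 by (auto elim!: fieldE)
    then have "(\<tau> ^^ j) x = x" if "x \<in> field" for x j
      using that by (induction j) auto
    then have "f \<xi> = \<xi>" if "f \<in> cyclic_subgroup field \<tau>" for f
      using that basis_in_field by (auto simp: cyclic_subgroup_def)
    then have "conjugation \<xi> = \<xi>"
      using cyc conjugation_in_galois_group by blast
    then show False
      using conjugation_elt[of 0 0 1 0] elt_eq_iff[of 0 0 "- 1" 0 0 0 1 0] by (simp add: elt_basis)
  qed
  obtain \<epsilon>2 \<delta>2 where t2: "\<epsilon>2 = 1 \<or> \<epsilon>2 = - 1" "\<delta>2 = 1 \<or> \<delta>2 = - 1"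
    "\<And>a b c e. \<sigma> (elt a b c e) = elt a (\<epsilon>2 * b) (\<delta>2 * c) (\<epsilon>2 * \<delta>2 * e)"
    by (rule galois_group_elt[OF \<sigma>(1)]) blast
  \<comment> \<open>Otherwise \<sigma> fixes \<zeta> and lies in the group generated by
    \<tau>.\<close>
  have e2: "\<epsilon>2 = - 1"
  proof (rule ccontr)
    assume "\<epsilon>2 \<noteq> - 1"
    then have "\<sigma> \<zeta> = \<zeta>"
      using t2(1) t2(3)[of 0 1 0 0] by (auto simp: elt_basis)
    then show False using \<sigma> gal basis_in_field by auto
  qed
  have d2: "\<delta>2 * \<delta>2 = 1"
    using t2(2) by auto
  have image: "of_rat a' * x + of_rat b' * \<tau> x + of_rat c' * (\<sigma> x + \<sigma> (\<tau> x))
      + of_rat e' * (\<zeta> * (\<sigma> x - \<sigma> (\<tau> x))) =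
    elt ((a' + b' + 2 * c') * a) ((a' + b' - 2 * c') * b)
      ((a' - b') * c - 2 * \<delta>2 * e' * t * e) (2 * \<delta>2 * e' * s * c + (a' - b') * e)"
    if x: "x = elt a b c e" for x a' b' c' e' a b c e
  proof -
    have "\<zeta> * (\<sigma> x - \<sigma> (\<tau> x)) = elt 0 0 (- 2 * \<delta>2 * t * e) (2 * \<delta>2 * s * c)"
      using elt_mult[of 0 1 0 0 0 0 "2 * \<delta>2 * c" "- 2 * \<delta>2 * e"]
      unfolding x t1 t2 e1 d1 e2 diff_conv_add_uminus elt_add elt_uminus elt_basis
      by (simp add: elt_eq_iff algebra_simps)
    then show ?thesis
      unfolding x t1 t2 e1 d1 e2
      by (simp add: elt_scale elt_add elt_eq_iff algebra_simps)
  qed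
  show ?thesis
  proof
    assume "h \<in> H"
    then obtain a' b' c' e' where h: "h = (\<lambda>x\<in>field. of_rat a' * x + of_rat b' * \<tau> x
        + of_rat c' * (\<sigma> x + \<sigma> (\<tau> x)) + of_rat e' * (\<zeta> * (\<sigma> x - \<sigma> (\<tau> x))))"
      unfolding H by blast
    have "h (elt a b c e) = elt ((a' + b' + 2 * c') * a) ((a' + b' - 2 * c') * b)
      ((a' - b') * c - 2 * \<delta>2 * e' * t * e) (2 * \<delta>2 * e' * s * c + (a' - b') * e)" for a b c e
      unfolding h using image[OF refl] by simp
    then show "h \<in> extensional field \<and> (\<exists>A B p q. \<forall>a b c e.
        h (elt a b c e) = elt (A * a) (B * b) (p * c - q * t * e) (q * s * c + p * e))"
      unfolding h by blast
  next
    assume "h \<in> extensional field \<and> (\<exists>A B p q. \<forall>a b c e.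
        h (elt a b c e) = elt (A * a) (B * b) (p * c - q * t * e) (q * s * c + p * e))"
    then obtain A B p q where ext: "h \<in> extensional field" and h: "\<And>a b c e.
        h (elt a b c e) = elt (A * a) (B * b) (p * c - q * t * e) (q * s * c + p * e)"
      by blast
    \<comment> \<open>The inverse linear change of parameters; the sign \<open>\<delta>2\<close>,
      which depends on the choice of \<sigma>, is its own inverse.\<close>
    define a' b' c' e' where "a' = (A + B + 2 * p) / 4" and "b' = (A + B - 2 * p) / 4"
      and "c' = (A - B) / 4" and "e' = \<delta>2 * q / 2"
    have par: "a' + b' + 2 * c' = A" "a' + b' - 2 * c' = B" "a' - b' = p" "2 * \<delta>2 * e' = q"
      using d2 by (simp_all add: a'_def b'_def c'_def e'_def field_simps)
    have "h = (\<lambda>x\<in>field. of_rat a' * x + of_rat b' * \<tau> x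
        + of_rat c' * (\<sigma> x + \<sigma> (\<tau> x)) + of_rat e' * (\<zeta> * (\<sigma> x - \<sigma> (\<tau> x))))"
    proof (rule extensionalityI[OF ext])
      fix x assume "x \<in> field"
      then obtain a b c e where x: "x = elt a b c e" by (rule fieldE)
      show "h x = (\<lambda>x\<in>field. of_rat a' * x + of_rat b' * \<tau> x
        + of_rat c' * (\<sigma> x + \<sigma> (\<tau> x)) + of_rat e' * (\<zeta> * (\<sigma> x - \<sigma> (\<tau> x)))) x"
        using image[OF x, of a' b' c' e'] h \<open>x \<in> field\<close> unfolding par by (simp add: x)
    qed simp
    then show "h \<in> H" unfolding H by blast
  qed
qed

end

section \<open>Integrality and unimodularity\<close>

lemma square_mod_4: "(i::int) * i mod 4 = (if even i then 0 else 1)"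
proof (cases "even i")
  case True
  then obtain k where "i = 2 * k" by (rule evenE)
  then have "i * i = 4 * (k * k)" by simp
  then show ?thesis using True by simp
next
  case False
  then obtain k where "i = 2 * k + 1" by (rule oddE)
  then have "i * i = 1 + 4 * (k * k + k)" by (simp add: algebra_simps)
  then show ?thesis using False by (simp del: distrib_left_numeral)
qed

lemma algebraic_int_of_int: "algebraic_int (of_int i :: complex)"
  by (rule int_imp_algebraic_int) simp

lemma algebraic_int_square_root:
  fixes x :: complex
  assumes "algebraic_int (x * x)"
  shows "algebraic_int x"
proof -
  have *: "lead_coeff (monom (1::complex) 2) = 1" "degree (monom (1::complex) 2) = 2"
    by (auto simp: degree_monom_eq)
  show ?thesis
    by (rule algebraic_int_root[OF assms, of "monom 1 2"])
      (use * in \<open>auto simp: poly_monom power2_eq_square\<close>)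
qed

lemma algebraic_int_of_rat:
  assumes "algebraic_int (of_rat r :: complex)"
  shows "r \<in> \<int>"
proof -
  have "(of_rat r :: complex) \<in> \<int>"
    using assms by (intro rational_algebraic_int_is_int) auto
  then obtain i where "(of_rat r :: complex) = of_int i"
    by (auto elim: Ints_cases)
  then have "r = of_int i"
    by (metis of_rat_eq_iff of_rat_of_int_eq)
  then show ?thesis by simp
qed

lemma rat_square_Ints:
  fixes r :: rat
  assumes "r * r \<in> \<int>"
  shows "r \<in> \<int>"
proof (rule algebraic_int_of_rat, rule algebraic_int_square_root)
  obtain i where "r * r = of_int i"
    using assms by (auto elim: Ints_cases)
  then have "(of_rat r * of_rat r :: complex) = of_int i"
    by (metis of_rat_mult of_rat_of_int_eq)
  then show "algebraic_int (of_rat r * of_rat r :: complex)"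
    by (simp add: algebraic_int_of_int)
qed

text \<open>A rational square root of an integer is an integer, and integer squares are 0 or 1
  modulo 4. The three radicands are 2 or 3 modulo 4, so this one residue condition covers them
  all.\<close>

lemma not_rat_square:
  fixes r :: rat
  assumes "N mod 4 = 2 \<or> N mod 4 = 3"
  shows "r * r \<noteq> of_int N"
proof
  assume r: "r * r = of_int N"
  then obtain i where "r = of_int i"
    using rat_square_Ints[of r] by (auto elim: Ints_cases)
  then have "i * i = N"
    using r by (metis of_int_eq_iff of_int_mult)
  then show False
    using assms square_mod_4[of i] by (auto split: if_splits)
qed

lemma independent_sqrt:
  fixes w :: complex
  assumes "w * w = of_int N" "N mod 4 = 2 \<or> N mod 4 = 3" "of_rat a + of_rat b * w = 0"
  shows "a = 0 \<and> b = 0"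
proof -
  have "b = 0"
  proof (rule ccontr)
    assume "b \<noteq> 0"
    then have w: "w = of_rat (- a / b)"
      using assms(3) by (simp add: of_rat_divide of_rat_minus field_simps eq_neg_iff_add_eq_0)
    then have "of_rat (- a / b * (- a / b)) = (of_rat (of_int N) :: complex)"
      using assms(1) by (metis of_rat_mult of_rat_of_int_eq)
    then show False
      using not_rat_square[OF assms(2)] by (metis of_rat_eq_iff)
  qed
  then show ?thesis using assms(3) by simp
qed

text \<open>With \<open>r = p / q\<close> in lowest terms, \<open>q * q\<close> divides
  \<open>N * (p * p)\<close>, hence \<open>N\<close>, and squarefreeness leaves
  \<open>q = 1\<close>.\<close>

lemma squarefree_mult_square_Ints:
  fixes r :: rat
  assumes "squarefree N" "of_int N * (r * r) \<in> \<int>"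
  shows "r \<in> \<int>"
proof -
  obtain p q where pq: "r = of_int p / of_int q" "q > 0" "coprime p q"
    by (metis prod.collapse quotient_of_coprime quotient_of_denom_pos quotient_of_div)
  obtain i where "of_int N * (r * r) = of_int i"
    using assms(2) by (auto elim: Ints_cases)
  then have "of_int N * (of_int p * of_int p) = of_int i * (of_int q * of_int q :: rat)"
    using pq by (simp add: field_simps)
  then have "N * (p * p) = i * (q * q)"
    by (metis of_int_eq_iff of_int_mult)
  then have "q * q dvd N * (p * p)" by simp
  then have "q * q dvd N"
    using pq(3) by (metis coprime_commute coprime_dvd_mult_left_iff coprime_mult_left_iff coprime_mult_right_iff)
  then have "is_unit q"
    using assms(1) unfolding squarefree_def power2_eq_square by blast
  then have "q = 1" using pq(2) by (simp add: zdvd1_eq)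
  then show ?thesis using pq by simp
qed

text \<open>Apply the preceding lemma to \<open>x / N\<close>: its square times \<open>N\<close> is
  the integer \<open>x * x / N\<close>.\<close>

lemma squarefree_dvd_square:
  fixes x :: int
  assumes "squarefree N" "N dvd x * x"
  shows "N dvd x"
proof -
  have "N \<noteq> 0" using assms(1) by auto
  obtain i where "x * x = N * i"
    using assms(2) by (auto elim: dvdE)
  then have "of_int x * of_int x = (of_int N * of_int i :: rat)"
    by (metis of_int_mult)
  then have "of_int N * (of_int x / of_int N * (of_int x / of_int N)) = (of_int i :: rat)"
    using \<open>N \<noteq> 0\<close> by simp
  then have "(of_int x / of_int N :: rat) \<in> \<int>"
    using squarefree_mult_square_Ints[OF assms(1)] by (metis Ints_of_int)
  then obtain j where "of_int x / of_int N = (of_int j :: rat)"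
    by (auto elim: Ints_cases)
  then have "of_int x = (of_int (N * j) :: rat)"
    using \<open>N \<noteq> 0\<close> by (simp add: divide_eq_eq mult.commute)
  then have "x = N * j"
    by (simp only: of_int_eq_iff)
  then show ?thesis by simp
qed

text \<open>Bezout. Testing a map on the integral basis controls the parameter \<open>q\<close> only
  through two coprime multiples, which are combined here.\<close>

lemma Ints_if_coprime_multiples:
  fixes q :: rat
  assumes "coprime a b" "q * of_int a \<in> \<int>" "q * of_int b \<in> \<int>"
  shows "q \<in> \<int>"
proof -
  obtain u v where "u * a + v * b = 1"
    using assms(1) by (metis bezout_int coprime_iff_gcd_eq_1)
  then have "of_int u * of_int a + of_int v * of_int b = (1 :: rat)"
    by (metis of_int_1 of_int_add of_int_mult)
  then have "q = of_int u * (q * of_int a) + of_int v * (q * of_int b)"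
    by (metis distrib_left mult.left_commute mult.right_neutral)
  also have "\<dots> \<in> \<int>" using assms(2,3) by simp
  finally show ?thesis .
qed

text \<open>The solutions for the two unit vectors form an integer inverse matrix, and determinants
  multiply.\<close>

lemma unit_det_if_surj:
  fixes \<alpha> \<beta> \<gamma> \<delta> :: int
  assumes "\<And>u v. \<exists>p q. \<alpha> * p + \<beta> * q = u \<and> \<gamma> * p + \<delta> * q = v"
  shows "\<alpha> * \<delta> - \<beta> * \<gamma> = 1 \<or> \<alpha> * \<delta> - \<beta> * \<gamma> = - 1"
proof -
  obtain p q p' q' where 1: "\<alpha> * p + \<beta> * q = 1" "\<gamma> * p + \<delta> * q = 0"
    "\<alpha> * p' + \<beta> * q' = 0" "\<gamma> * p' + \<delta> * q' = 1"
    using assms[of 1 0] assms[of 0 1] by blast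
  have "(\<alpha> * \<delta> - \<beta> * \<gamma>) * (p * q' - q * p') =
      (\<alpha> * p + \<beta> * q) * (\<gamma> * p' + \<delta> * q') - (\<alpha> * p' + \<beta> * q') * (\<gamma> * p + \<delta> * q)"
    by (simp add: algebra_simps)
  then have "(\<alpha> * \<delta> - \<beta> * \<gamma>) * (p * q' - q * p') = 1"
    unfolding 1 by simp
  then show ?thesis by (auto simp: zmult_eq_1_iff)
qed

text \<open>Cramer's rule: the adjugate matrix times the determinant \<epsilon>, which is its own
  inverse.\<close>

lemma
  fixes \<alpha> \<beta> \<gamma> \<delta> :: int
  assumes det: "\<alpha> * \<delta> - \<beta> * \<gamma> = 1 \<or> \<alpha> * \<delta> - \<beta> * \<gamma> = - 1"
  shows unit_det_imp_surj: "\<exists>p q. \<alpha> * p + \<beta> * q = u \<and> \<gamma> * p + \<delta> * q = v"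
    and unit_det_imp_inj: "\<alpha> * p + \<beta> * q = \<alpha> * p' + \<beta> * q' \<Longrightarrow> \<gamma> * p + \<delta> * q = \<gamma> * p' + \<delta> * q' \<Longrightarrow>
      p = p' \<and> q = q'"
proof -
  define \<epsilon> where "\<epsilon> = \<alpha> * \<delta> - \<beta> * \<gamma>"
  have \<epsilon>: "\<epsilon> * \<epsilon> = 1" using det by (auto simp: \<epsilon>_def)
  have "\<alpha> * (\<epsilon> * (\<delta> * u - \<beta> * v)) + \<beta> * (\<epsilon> * (\<alpha> * v - \<gamma> * u)) = \<epsilon> * (\<alpha> * \<delta> - \<beta> * \<gamma>) * u"
    "\<gamma> * (\<epsilon> * (\<delta> * u - \<beta> * v)) + \<delta> * (\<epsilon> * (\<alpha> * v - \<gamma> * u)) = \<epsilon> * (\<alpha> * \<delta> - \<beta> * \<gamma>) * v"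
    by (simp_all add: algebra_simps)
  then show "\<exists>p q. \<alpha> * p + \<beta> * q = u \<and> \<gamma> * p + \<delta> * q = v"
    unfolding \<epsilon>_def[symmetric] \<epsilon> by auto
  assume eq: "\<alpha> * p + \<beta> * q = \<alpha> * p' + \<beta> * q'" "\<gamma> * p + \<delta> * q = \<gamma> * p' + \<delta> * q'"
  have inv: "\<delta> * (\<alpha> * x + \<beta> * y) - \<beta> * (\<gamma> * x + \<delta> * y) = \<epsilon> * x"
    "\<alpha> * (\<gamma> * x + \<delta> * y) - \<gamma> * (\<alpha> * x + \<beta> * y) = \<epsilon> * y" for x y
    by (simp_all add: \<epsilon>_def algebra_simps)
  have "\<epsilon> \<noteq> 0" using \<epsilon> by auto
  then show "p = p' \<and> q = q'"
    using inv[of p q] inv[of p' q'] unfolding eq by simp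
qed

text \<open>The dictionary used for all three structures: \<open>W\<close> gives coordinates on the
  ring of integers, \<open>\<Phi>\<close> parametrises the order, and \<open>D b\<close> is
  evaluation at \<open>W b\<close> read in coordinates.\<close>

lemma free_generator_imp_surj:
  assumes "free_generator L H \<beta>" and "ring_of_integers L = range W" and "associated_order L H = range \<Phi>"
    and act: "\<And>t b. \<Phi> t (W b) = W (D b t)" and "inj W"
  obtains b where "\<beta> = W b" "surj (D b)"
proof -
  obtain b where b: "\<beta> = W b"
    using assms(1,2) by (auto simp: free_generator_def)
  have "(\<lambda>h. h \<beta>) ` range \<Phi> = range W"
    using assms(1,2,3) by (simp add: free_generator_def bij_betw_def)
  then have "range (\<lambda>t. W (D b t)) = range W"
    by (simp add: image_image b act)
  then have "\<exists>t. W y = W (D b t)" for y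
    by blast
  then have "surj (D b)"
    using \<open>inj W\<close> unfolding surj_def inj_def by blast
  with b show ?thesis by (rule that)
qed

text \<open>Equal values at \<open>W b\<close> come from equal parameters, as \<open>W\<close> and
  \<open>D b\<close> are injective, hence from equal maps.\<close>

lemma free_generator_if_bij:
  assumes "ring_of_integers L = range W" and "associated_order L H = range \<Phi>"
    and act: "\<And>t b. \<Phi> t (W b) = W (D b t)" and "inj W" and bij: "bij (D b)"
  shows "free_generator L H (W b)"
  unfolding free_generator_def assms(1,2)
proof
  show "W b \<in> range W" by simp
  have "inj_on (\<lambda>h. h (W b)) (range \<Phi>)"
  proof (rule inj_onI, elim rangeE)
    fix h h' t t'
    assume h: "h (W b) = h' (W b)" "h = \<Phi> t" "h' = \<Phi> t'"
    then have "W (D b t) = W (D b t')" by (simp add: act)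
    then have "t = t'" using \<open>inj W\<close> bij by (simp add: inj_eq bij_is_inj)
    with h show "h = h'" by simp
  qed
  moreover have "(\<lambda>h. h (W b)) ` range \<Phi> = W ` range (D b)"
    by (simp add: image_image act)
  then have "(\<lambda>h. h (W b)) ` range \<Phi> = range W"
    using bij by (simp add: bij_is_surj)
  ultimately show "bij_betw (\<lambda>h. h (W b)) (range \<Phi>) (range W)"
    by (simp add: bij_betw_def)
qed

lemma associated_order_eq_range:
  assumes "ring_of_integers L = range W" and act: "\<And>t b. \<Phi> t (W b) = W (D b t)"
    and "\<And>t. \<Phi> t \<in> H"
    and "\<And>h. h \<in> H \<Longrightarrow> (\<And>b. h (W b) \<in> range W) \<Longrightarrow> h \<in> range \<Phi>"
  shows "associated_order L H = range \<Phi>"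
  using assms by (auto simp: associated_order_def image_subset_iff)

text \<open>The trace \<open>2 * a\<close> and the norm \<open>a * a - N * (b * b)\<close> are
  integers. Squarefreeness of \<open>N\<close> then bounds the denominator of \<open>b\<close> by 2,
  and a congruence modulo 4 removes the remaining halves.\<close>

lemma quadratic_algebraic_int:
  fixes w :: complex
  assumes w: "w * w = of_int N" and N: "squarefree N" "N mod 4 = 2 \<or> N mod 4 = 3"
    and int: "algebraic_int (of_rat a + of_rat b * w)" "algebraic_int (of_rat a - of_rat b * w)"
  shows "a \<in> \<int> \<and> b \<in> \<int>"
proof -
  have "algebraic_int (of_rat (2 * a) :: complex)"
    using algebraic_int_add[OF int] by (simp add: of_rat_mult)
  then obtain A where A: "2 * a = of_int A"
    using algebraic_int_of_rat by (auto elim: Ints_cases)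
  have "(of_rat a + of_rat b * w) * (of_rat a - of_rat b * w) =
      of_rat a * of_rat a - of_rat b * of_rat b * (w * w)"
    by (simp add: algebra_simps)
  also have "\<dots> = of_rat (a * a - of_int N * (b * b))"
    unfolding w by (simp add: of_rat_diff of_rat_mult)
  finally have "algebraic_int (of_rat (a * a - of_int N * (b * b)) :: complex)"
    using algebraic_int_mult[OF int] by simp
  then obtain M where M: "a * a - of_int N * (b * b) = of_int M"
    using algebraic_int_of_rat by (auto elim: Ints_cases)
  have "of_int N * ((2 * b) * (2 * b)) = (2 * a) * (2 * a) - 4 * (of_int M :: rat)"
    using M by (simp add: algebra_simps)
  also have "\<dots> = of_int (A * A - 4 * M)"
    unfolding A by simp
  finally have "2 * b \<in> \<int>"
    using squarefree_mult_square_Ints[OF N(1)] by (metis Ints_of_int)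
  then obtain B where B: "2 * b = of_int B"
    by (auto elim: Ints_cases)
  have "of_int (A * A - N * (B * B)) = (of_int (4 * M) :: rat)"
    using M unfolding of_int_mult of_int_diff A[symmetric] B[symmetric] by (simp add: algebra_simps)
  then have "A * A - N * (B * B) = 4 * M"
    by (simp only: of_int_eq_iff)
  then have "(A * A - N * (B * B)) mod 4 = 0" by simp
  \<comment> \<open>Squares are 0 or 1 modulo 4 and \<open>N\<close> is 2 or 3, so
    \<open>A * A\<close> and \<open>N * (B * B)\<close> can agree modulo 4 only if \<open>A\<close>
    and \<open>B\<close> are even.\<close>
  moreover have "A * A - N * (B * B) =
      4 * (A * A div 4 - N * (B * B div 4)) + (A * A mod 4 - N * (B * B mod 4))"
    by (simp add: algebra_simps flip: minus_mod_eq_mult_div)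
  ultimately have "(A * A mod 4 - N * (B * B mod 4)) mod 4 = 0"
    by presburger
  then have "even A \<and> even B"
    using N(2) by (auto simp: square_mod_4 split: if_splits) presburger+
  then obtain A' B' where "A = 2 * A'" "B = 2 * B'" by (auto elim!: evenE)
  then have "a = of_int A'" "b = of_int B'"
    using A B by simp_all
  then show ?thesis by simp
qed

section \<open>The ring of integers\<close>

lemmas of_rat_ring = of_rat_add of_rat_mult of_rat_diff of_rat_minus of_rat_of_int_eq of_int_mult
  of_int_numeral of_rat_numeral_eq

text \<open>The number \<open>f\<close> records that \<open>m = d m'\<close> is 3 modulo 4: d (d +
  m') = d^2 + m with \<open>d\<close> odd. Only \<open>d\<close> is positive; \<open>m'\<close> and
  \<open>g\<close> may be negative.\<close>

locale biquadratic_field =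
  fixes d m' g f :: int and rm rn rk :: complex
  assumes d: "0 < d" "odd d" and g: "odd g" and f: "d + m' = 4 * f"
    and coprime: "coprime d m'" "coprime d g" "coprime m' g"
    and sqfree: "squarefree (d * m')" "squarefree (2 * d * g)" "squarefree (2 * m' * g)"
    and rm: "rm * rm = of_int (d * m')" and rn: "rn * rn = of_int (2 * d * g)"
    and rk: "rk = rm * rn / of_int d"
begin

section \<open>Relations between the three square roots\<close>

lemma odd_m': "odd m'"
  using d f by presburger

lemma radicand_mod_4: "d * m' mod 4 = 3" "2 * d * g mod 4 = 2" "2 * m' * g mod 4 = 2"
proof -
  have "d * m' = 4 * (d * f) - d * d"
    using f by (simp add: algebra_simps flip: distrib_left)
  moreover have "d * d mod 4 = 1"
    using square_mod_4 d by simp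
  ultimately show "d * m' mod 4 = 3" by presburger
  have *: "2 * i mod 4 = 2" if "odd i" for i :: int
    using that by presburger
  show "2 * d * g mod 4 = 2" "2 * m' * g mod 4 = 2"
    using *[of "d * g"] *[of "m' * g"] d g odd_m' by (simp_all add: mult.assoc)
qed

lemma products:
  "rm * rn = of_int d * rk" "rm * rk = of_int m' * rn" "rn * rk = of_int (2 * g) * rm"
  "rk * rk = of_int (2 * m' * g)"
proof -
  show "rm * rn = of_int d * rk" using d by (simp add: rk)
  have "rm * rk = (rm * rm) * rn / of_int d" by (simp add: rk)
  then show 1: "rm * rk = of_int m' * rn" using d unfolding rm by simp
  have "rn * rk = (rn * rn) * rm / of_int d" by (simp add: rk)
  then show "rn * rk = of_int (2 * g) * rm" using d unfolding rn by simp
  have "rk * rk = (rm * rk) * rn / of_int d" by (simp add: rk)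
  also have "\<dots> = of_int m' * (rn * rn) / of_int d" unfolding 1 by simp
  finally show "rk * rk = of_int (2 * m' * g)" using d unfolding rn by simp
qed

lemma independent:
  assumes "of_rat a + of_rat b * rm + of_rat c * rn + of_rat e * rk = 0"
  shows "a = 0 \<and> b = 0 \<and> c = 0 \<and> e = 0"
proof -
  note mods = radicand_mod_4
  \<comment> \<open>Squaring the relation with two of its four terms on each side, in two ways, gives \<open>a\<^sup>2 = 2 m' g e\<^sup>2\<close>.\<close>
  have split: "P = Q \<and> X = 0" if "w * w = of_int N" "N mod 4 = 2 \<or> N mod 4 = 3"
    "of_rat P + of_rat X * w = of_rat Q" for P X Q :: rat and w :: complex and N
    using independent_sqrt[OF that(1,2), of "P - Q" X] by (simp add: of_rat_diff flip: that(3))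
  have "(of_rat a + of_rat b * rm) * (of_rat a + of_rat b * rm) =
      (of_rat c * rn + of_rat e * rk) * (of_rat c * rn + of_rat e * rk)"
    using assms by (metis add.assoc add_eq_0_iff minus_mult_minus)
  then have "of_rat a * of_rat a + of_rat b * of_rat b * (rm * rm) + 2 * of_rat a * of_rat b * rm =
      of_rat c * of_rat c * (rn * rn) + of_rat e * of_rat e * (rk * rk) + 2 * of_rat c * of_rat e * (rn * rk)"
    by (simp add: algebra_simps)
  moreover have "of_rat (a * a + b * b * of_int (d * m')) + of_rat (2 * a * b - 4 * of_int g * c * e) * rm -
      of_rat (c * c * of_int (2 * d * g) + e * e * of_int (2 * m' * g)) =
      of_rat a * of_rat a + of_rat b * of_rat b * (rm * rm) + 2 * of_rat a * of_rat b * rm -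
      (of_rat c * of_rat c * (rn * rn) + of_rat e * of_rat e * (rk * rk) + 2 * of_rat c * of_rat e * (rn * rk))"
    unfolding rm rn products
    by (simp only: of_rat_ring) (simp only: ring_distribs mult_ac add_ac diff_conv_add_uminus, simp)
  ultimately have "of_rat (a * a + b * b * of_int (d * m')) + of_rat (2 * a * b - 4 * of_int g * c * e) * rm =
      of_rat (c * c * of_int (2 * d * g) + e * e * of_int (2 * m' * g))"
    by (metis eq_iff_diff_eq_0)
  from split[OF rm _ this] mods
  have 1: "a * a + b * b * of_int (d * m') = c * c * of_int (2 * d * g) + e * e * of_int (2 * m' * g)"
    by blast
  have "of_rat a + of_rat c * rn = - (of_rat b * rm + of_rat e * rk)"
    using assms unfolding eq_neg_iff_add_eq_0 by (simp add: add_ac)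
  then have "(of_rat a + of_rat c * rn) * (of_rat a + of_rat c * rn) =
      (of_rat b * rm + of_rat e * rk) * (of_rat b * rm + of_rat e * rk)"
    by (metis minus_mult_minus)
  then have "of_rat a * of_rat a + of_rat c * of_rat c * (rn * rn) + 2 * of_rat a * of_rat c * rn =
      of_rat b * of_rat b * (rm * rm) + of_rat e * of_rat e * (rk * rk) + 2 * of_rat b * of_rat e * (rm * rk)"
    by (simp add: algebra_simps)
  moreover have "of_rat (a * a + c * c * of_int (2 * d * g)) + of_rat (2 * a * c - 2 * of_int m' * b * e) * rn -
      of_rat (b * b * of_int (d * m') + e * e * of_int (2 * m' * g)) =
      of_rat a * of_rat a + of_rat c * of_rat c * (rn * rn) + 2 * of_rat a * of_rat c * rn -
      (of_rat b * of_rat b * (rm * rm) + of_rat e * of_rat e * (rk * rk) + 2 * of_rat b * of_rat e * (rm * rk))"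
    unfolding rm rn products
    by (simp only: of_rat_ring) (simp only: ring_distribs mult_ac add_ac diff_conv_add_uminus, simp)
  ultimately have "of_rat (a * a + c * c * of_int (2 * d * g)) + of_rat (2 * a * c - 2 * of_int m' * b * e) * rn =
      of_rat (b * b * of_int (d * m') + e * e * of_int (2 * m' * g))"
    by (metis eq_iff_diff_eq_0)
  from split[OF rn _ this] mods
  have 2: "a * a + c * c * of_int (2 * d * g) = b * b * of_int (d * m') + e * e * of_int (2 * m' * g)"
    by blast
  have square: "x = 0 \<and> y = 0" if "x * x = y * y * of_int N" "N mod 4 = 2 \<or> N mod 4 = 3"
    for x y :: rat and N
  proof (cases "y = 0")
    case False
    then have "x / y * (x / y) = of_int N"
      using that(1) by simp
    then show ?thesis using not_rat_square[OF that(2)] by blast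
  qed (use that(1) in simp)
  \<comment> \<open>Adding 1 and 2 cancels the terms in \<open>b\<close> and \<open>c\<close>; a
    nonzero \<open>e\<close> would make \<open>2 * m' * g\<close> a rational square.\<close>
  have "a = 0 \<and> e = 0"
    using 1 2 mods by (intro square[of a e "2 * m' * g"]) auto
  then have "of_rat b * rm + of_rat c * rn = 0"
    using assms by simp
  \<comment> \<open>Multiplication by \<open>rm\<close> turns the remaining relation into one
    between 1 and \<open>rk\<close>.\<close>
  then have "0 = (of_rat b * rm + of_rat c * rn) * rm"
    by simp
  also have "\<dots> = of_rat b * (rm * rm) + of_rat c * (rm * rn)"
    by (simp only: ring_distribs mult_ac)
  also have "\<dots> = of_rat (b * of_int (d * m')) + of_rat (c * of_int d) * rk"
    unfolding rm products by (simp only: of_rat_ring mult.assoc)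
  finally have "of_rat (b * of_int (d * m')) + of_rat (c * of_int d) * rk = 0" ..
  then have "b * of_int (d * m') = 0 \<and> c * of_int d = 0"
    using mods by (intro independent_sqrt[OF products(4)]) auto
  then show ?thesis
    using \<open>a = 0 \<and> e = 0\<close> d odd_m' by auto
qed

text \<open>This and the next two interpretations let \<open>rm\<close>, \<open>rn\<close>,
  \<open>rk\<close> in turn be the labelling root; \<open>s\<close> and \<open>t\<close> are read
  off from \<open>products\<close>.\<close>

sublocale M: biquadratic_basis rm rn rk "of_int (2 * d * g)" "of_int d" "of_int m'"
proof unfold_locales
  show "a = 0 \<and> b = 0 \<and> c = 0 \<and> e = 0"
    if "of_rat a + of_rat b * rm + of_rat c * rn + of_rat e * rk = 0" for a b c e
    using independent[OF that] .
  show "rat_of_int d \<noteq> 0"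
    using d by simp
qed (simp_all only: products rn of_rat_of_int_eq)

sublocale N: biquadratic_basis rn rm rk "of_int (d * m')" "of_int d" "of_int (2 * g)"
proof unfold_locales
  show "a = 0 \<and> b = 0 \<and> c = 0 \<and> e = 0"
    if "of_rat a + of_rat b * rn + of_rat c * rm + of_rat e * rk = 0" for a b c e
    using independent[of a c b e] that by (simp only: add_ac)
  show "rn * rm = of_rat (of_int d) * rk"
    by (simp only: mult.commute[of rn rm] products of_rat_of_int_eq)
  show "rat_of_int d \<noteq> 0"
    using d by simp
qed (simp_all only: products rm of_rat_of_int_eq)

sublocale K: biquadratic_basis rk rm rn "of_int (d * m')" "of_int m'" "of_int (2 * g)"
proof unfold_locales
  show "a = 0 \<and> b = 0 \<and> c = 0 \<and> e = 0"
    if "of_rat a + of_rat b * rk + of_rat c * rm + of_rat e * rn = 0" for a b c e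
    using independent[of a c e b] that by (simp only: add_ac)
  show "rk * rm = of_rat (of_int m') * rn" "rk * rn = of_rat (of_int (2 * g)) * rm"
    by (simp_all only: mult.commute[of rk rm] mult.commute[of rk rn] products of_rat_of_int_eq)
  show "rat_of_int m' \<noteq> 0"
    using odd_m' by auto
qed (simp_all only: rm of_rat_of_int_eq)

section \<open>The integral basis\<close>

abbreviation L :: "complex set" where "L \<equiv> M.field"
abbreviation V :: "rat \<Rightarrow> rat \<Rightarrow> rat \<Rightarrow> rat \<Rightarrow> complex" where "V \<equiv> M.elt"

text \<open>All later work can thus stay in the single basis 1, \<open>rm\<close>,
  \<open>rn\<close>, \<open>rk\<close>.\<close>

lemma elt_permute: "N.elt a c b e = V a b c e" "K.elt a e b c = V a b c e"
  by (simp_all add: M.elt_def N.elt_def K.elt_def)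

lemma field_eq: "N.field = L" "K.field = L"
  unfolding M.field_def N.field_def K.field_def elt_permute by blast+

text \<open>The arguments are coordinates in the integral basis of the theorem; the halves come from
  \<open>(rn + rk) / 2\<close>.\<close>

fun W :: "int \<times> int \<times> int \<times> int \<Rightarrow> complex" where
  "W (x, y, z, w) = V (of_int x) (of_int y) (of_int z + of_int w / 2) (of_int w / 2)"

lemma W_eq: "W (x, y, z, w) = of_int x + of_int y * rm + of_int z * rn + of_int w * ((rn + rk) / 2)"
  by (simp add: W.simps M.elt_def of_rat_add of_rat_divide algebra_simps add_divide_distrib)

text \<open>Only \<open>(rn + rk) / 2\<close> needs an argument: by d + m' = 4 f its square is 2 g f
  + g rm.\<close>

lemma algebraic_int_W: "algebraic_int (W (x, y, z, w))"
proof -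
  have i: "algebraic_int rm" "algebraic_int rn"
    using algebraic_int_square_root algebraic_int_of_int rm rn by metis+
  have "((rn + rk) / 2) * ((rn + rk) / 2) = (rn * rn + rk * rk + 2 * (rn * rk)) / 4"
    by (simp add: field_simps)
  also have "rn * rn + rk * rk = of_int (2 * g * (d + m'))"
    unfolding rn products of_int_add[symmetric] by (simp only: ring_distribs mult_ac)
  also have "(\<dots> + 2 * (rn * rk)) / 4 = of_int (2 * g * f) + of_int g * rm"
    unfolding f products by simp
  finally have "algebraic_int ((rn + rk) / 2 * ((rn + rk) / 2))"
    using i by (metis algebraic_int_add algebraic_int_mult algebraic_int_of_int)
  then have "algebraic_int ((rn + rk) / 2)"
    by (rule algebraic_int_square_root)
  then show ?thesis
    unfolding W_eq by (intro algebraic_int_add algebraic_int_mult algebraic_int_of_int i)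
qed

lemma algebraic_int_V_imp_W:
  assumes "algebraic_int (V a b c e)"
  obtains x y z w where "V a b c e = W (x, y, z, w)"
proof -
  \<comment> \<open>The conjugates over \<rat>(rm), \<rat>(rn) and \<rat>(rk), in this
    order.\<close>
  have conj: "algebraic_int (V a b (- c) (- e))" "algebraic_int (V a (- b) c (- e))"
    "algebraic_int (V a (- b) (- c) e)"
    using M.algebraic_int_conjugation[OF M.elt_in_field assms, unfolded M.conjugation_elt]
      N.algebraic_int_conjugation[OF N.elt_in_field, of a c b e, unfolded N.conjugation_elt, unfolded elt_permute]
      K.algebraic_int_conjugation[OF K.elt_in_field, of a e b c, unfolded K.conjugation_elt, unfolded elt_permute]
      assms
    by blast+
  \<comment> \<open>Traces to the three quadratic subfields bound the denominators by 2; the norm to \<open>\<rat>(rm)\<close>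
    then decides the parities of the numerators.\<close>
  have "of_rat (2 * a) + of_rat (2 * b) * rm = V a b c e + V a b (- c) (- e)"
    "of_rat (2 * a) - of_rat (2 * b) * rm = V a (- b) c (- e) + V a (- b) (- c) e"
    by (simp_all add: M.elt_add) (simp_all add: M.elt_def of_rat_mult of_rat_minus)
  then have ab: "2 * a \<in> \<int> \<and> 2 * b \<in> \<int>"
    using conj assms radicand_mod_4
    by (intro quadratic_algebraic_int[OF rm sqfree(1)]) (simp_all add: algebraic_int_add)
  have "of_rat (2 * a) + of_rat (2 * c) * rn = V a b c e + V a (- b) c (- e)"
    "of_rat (2 * a) - of_rat (2 * c) * rn = V a b (- c) (- e) + V a (- b) (- c) e"
    by (simp_all add: M.elt_add) (simp_all add: M.elt_def of_rat_mult of_rat_minus)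
  then have c: "2 * a \<in> \<int> \<and> 2 * c \<in> \<int>"
    using conj assms radicand_mod_4
    by (intro quadratic_algebraic_int[OF rn sqfree(2)]) (simp_all add: algebraic_int_add)
  have "of_rat (2 * a) + of_rat (2 * e) * rk = V a b c e + V a (- b) (- c) e"
    "of_rat (2 * a) - of_rat (2 * e) * rk = V a b (- c) (- e) + V a (- b) c (- e)"
    by (simp_all add: M.elt_add) (simp_all add: M.elt_def of_rat_mult of_rat_minus)
  then have e: "2 * a \<in> \<int> \<and> 2 * e \<in> \<int>"
    using conj assms radicand_mod_4
    by (intro quadratic_algebraic_int[OF products(4) sqfree(3)]) (simp_all add: algebraic_int_add)
  obtain A B C E where int: "2 * a = of_int A" "2 * b = of_int B" "2 * c = of_int C" "2 * e = of_int E"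
    using ab c e by (auto elim!: Ints_cases)
  \<comment> \<open>\<open>P + Q rm\<close> is the product of the element with its conjugate over
    \<rat>(rm).\<close>
  define P where "P = a * a + of_int (d * m') * (b * b) - of_int (2 * d * g) * (c * c) - of_int (2 * m' * g) * (e * e)"
  define Q where "Q = 2 * a * b - of_int (4 * g) * c * e"
  have d0: "of_int d \<noteq> (0 :: rat)" using d by simp
  have "of_rat P + of_rat Q * rm = V a b c e * V a b (- c) (- e)"
    "of_rat P - of_rat Q * rm = V a (- b) c (- e) * V a (- b) (- c) e"
  proof -
    have "of_rat P + of_rat Q * rm = V P Q 0 0" "of_rat P - of_rat Q * rm = V P (- Q) 0 0"
      by (simp_all add: M.elt_def of_rat_minus)
    then show "of_rat P + of_rat Q * rm = V a b c e * V a b (- c) (- e)"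
      "of_rat P - of_rat Q * rm = V a (- b) c (- e) * V a (- b) (- c) e"
      using d0 by (simp_all add: M.elt_mult M.elt_eq_iff P_def Q_def)
  qed
  then have PQ: "P \<in> \<int> \<and> Q \<in> \<int>"
    using conj assms radicand_mod_4
    by (intro quadratic_algebraic_int[OF rm sqfree(1)]) (simp_all add: algebraic_int_mult)
  then obtain P' Q' where PQ': "P = of_int P'" "Q = of_int Q'"
    by (auto elim!: Ints_cases)
  have "of_int (4 * P') = (2 * a) * (2 * a) + of_int (d * m') * ((2 * b) * (2 * b))
      - of_int (2 * d * g) * ((2 * c) * (2 * c)) - of_int (2 * m' * g) * ((2 * e) * (2 * e))"
    unfolding of_int_mult[of 4 P'] PQ'[symmetric] P_def by (simp add: algebra_simps)
  then have "of_int (4 * P') = (of_int (A * A + (d * m') * (B * B) - (2 * d * g) * (C * C) - (2 * m' * g) * (E * E)) :: rat)"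
    unfolding int by simp
  then have P4: "4 * P' = A * A + (d * m') * (B * B) - (2 * d * g) * (C * C) - (2 * m' * g) * (E * E)"
    by (simp only: of_int_eq_iff)
  have "of_int (2 * Q') = (2 * a) * (2 * b) - of_int (2 * g) * ((2 * c) * (2 * e))"
    unfolding of_int_mult[of 2 Q'] PQ'[symmetric] Q_def by (simp add: algebra_simps)
  then have "of_int (2 * Q') = (of_int (A * B - 2 * g * (C * E)) :: rat)"
    unfolding int by simp
  then have "2 * Q' = A * B - 2 * g * (C * E)"
    by (simp only: of_int_eq_iff)
  \<comment> \<open>Integrality of \<open>Q\<close> makes \<open>A * B\<close> even and that of
    \<open>P\<close> gives \<open>A\<close> and \<open>B\<close> equal parity, so both are
    even.\<close>
  then have "A * B = 2 * (Q' + g * (C * E))" by simp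
  then have "even (A * B)" by (metis dvd_triv_left)
  moreover have "even (4 * P')" by simp
  then have "even A \<longleftrightarrow> even B"
    unfolding P4 using d odd_m' by auto
  ultimately have "even A" "even B" by auto
  then obtain x y where xy: "A = 2 * x" "B = 2 * y" by (auto elim!: evenE)
  \<comment> \<open>What is left of the norm says that d C^2 + m' E^2 is even. As \<open>d\<close>
    and \<open>m'\<close> are odd, \<open>C\<close> and \<open>E\<close> have equal parity, which is
    the shape of the half-integral coordinates in \<open>W\<close>.\<close>
  have "2 * (g * (d * (C * C) + m' * (E * E))) = 4 * (x * x + (d * m') * (y * y) - P')"
    using P4 unfolding xy by (simp add: algebra_simps)
  then have "g * (d * (C * C) + m' * (E * E)) = 2 * (x * x + (d * m') * (y * y) - P')" by simp
  then have "even (g * (d * (C * C) + m' * (E * E)))" by (metis dvd_triv_left)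
  then have "even (C - E)" using g d odd_m' by auto
  then obtain z where z: "C = E + 2 * z" by (metis diff_eq_eq add.commute evenE)
  have "a = of_int x" "b = of_int y" "c = of_int z + of_int E / 2" "e = of_int E / 2"
    using int unfolding xy z by simp_all
  then have "V a b c e = W (x, y, z, E)"
    by (simp only: W.simps)
  then show ?thesis by (rule that)
qed

lemma ring_of_integers_eq: "ring_of_integers L = range W"
proof
  show "range W \<subseteq> ring_of_integers L"
    using algebraic_int_W by (force simp: ring_of_integers_def)
  show "ring_of_integers L \<subseteq> range W"
  proof
    fix x assume x: "x \<in> ring_of_integers L"
    then obtain a b c e where V: "x = V a b c e"
      by (auto simp: ring_of_integers_def elim!: M.fieldE)
    with x have "algebraic_int (V a b c e)"
      by (simp add: ring_of_integers_def)
    then show "x \<in> range W"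
      unfolding V by (rule algebraic_int_V_imp_W) (simp only: rangeI)
  qed
qed

section \<open>Associated orders and free generators\<close>

lemma V_eq_iff: "V a b c e = V a' b' c' e' \<longleftrightarrow> a = a' \<and> b = b' \<and> c = c' \<and> e = e'"
  by (rule M.elt_eq_iff)

lemma inj_W: "inj W"
  by (auto simp: inj_on_def V_eq_iff)

lemma V_in_range_W:
  assumes "V a b c e \<in> range W"
  shows "a \<in> \<int>" "b \<in> \<int>" "2 * e \<in> \<int>" "c - e \<in> \<int>"
proof -
  obtain x y z w where "V a b c e = W (x, y, z, w)"
    using assms by auto
  then have "a = of_int x" "b = of_int y" "2 * e = of_int w" "c - e = of_int z"
    by (auto simp: V_eq_iff)
  then show "a \<in> \<int>" "b \<in> \<int>" "2 * e \<in> \<int>" "c - e \<in> \<int>"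
    by simp_all
qed

lemma m'_rat: "of_int m' = (4 * of_int f - of_int d :: rat)"
proof -
  have "(of_int (d + m') :: rat) = of_int (4 * f)" by (simp only: f)
  then show ?thesis by simp
qed

lemma eq_sign_mult: "(a :: int) = c \<or> a = - c \<Longrightarrow> \<exists>s. (s = 1 \<or> s = - 1) \<and> a = s * c"
  by auto

text \<open>Here J rn = d rk and J rk = - m' rn. In \<open>act2\<close>, J rm = d rk and J rk = - 2
  g rm; in \<open>act3\<close>, J rm = m' rn and J rn = - 2 g rm.\<close>

definition act1 :: "rat \<Rightarrow> rat \<Rightarrow> rat \<Rightarrow> rat \<Rightarrow> complex \<Rightarrow> complex" where
  "act1 A B p q = M.linmap (\<lambda>a b c e. V (A * a) (B * b) (p * c - q * of_int m' * e) (q * of_int d * c + p * e))"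

definition act2 :: "rat \<Rightarrow> rat \<Rightarrow> rat \<Rightarrow> rat \<Rightarrow> complex \<Rightarrow> complex" where
  "act2 A B p q = M.linmap (\<lambda>a b c e. V (A * a) (p * b - q * of_int (2 * g) * e) (B * c) (q * of_int d * b + p * e))"

definition act3 :: "rat \<Rightarrow> rat \<Rightarrow> rat \<Rightarrow> rat \<Rightarrow> complex \<Rightarrow> complex" where
  "act3 A B p q = M.linmap (\<lambda>a b c e. V (A * a) (p * b - q * of_int (2 * g) * c) (q * of_int m' * b + p * c) (B * e))"

lemma hopf1:
  assumes "hopf_galois_at L rm H"
  shows "h \<in> H \<longleftrightarrow> (\<exists>A B p q. h = act1 A B p q)"
  unfolding M.hopf_galois_at_iff[OF assms] act1_def M.eq_linmap_iff by blast

lemma hopf2: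
  assumes "hopf_galois_at L rn H"
  shows "h \<in> H \<longleftrightarrow> (\<exists>A B p q. h = act2 A B p q)"
proof -
  have "h \<in> H \<longleftrightarrow> h \<in> extensional L \<and> (\<exists>A B p q. \<forall>a c b e.
      h (V a b c e) = V (A * a) (p * b - q * of_int (2 * g) * e) (B * c) (q * of_int d * b + p * e))"
    using N.hopf_galois_at_iff[of H h] assms by (simp only: field_eq elt_permute)
  then show ?thesis
    unfolding act2_def M.eq_linmap_iff by blast
qed

lemma hopf3:
  assumes "hopf_galois_at L rk H"
  shows "h \<in> H \<longleftrightarrow> (\<exists>A B p q. h = act3 A B p q)"
proof -
  have "h \<in> H \<longleftrightarrow> h \<in> extensional L \<and> (\<exists>A B p q. \<forall>a e b c.
      h (V a b c e) = V (A * a) (p * b - q * of_int (2 * g) * c) (q * of_int m' * b + p * c) (B * e))"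
    using K.hopf_galois_at_iff[of H h] assms by (simp only: field_eq elt_permute)
  then show ?thesis
    unfolding act3_def M.eq_linmap_iff by blast
qed

text \<open>
  The integral conditions on \<open>act1 A B p q\<close> are \<open>A, B, p - q d, 2 q \<in> \<int>\<close>; those on \<open>act2\<close> and \<open>act3\<close>
  are \<open>A, p, q, (B - p) / 2 \<in> \<int>\<close>.
\<close>

fun order1 :: "int \<times> int \<times> int \<times> int \<Rightarrow> complex \<Rightarrow> complex" where
  "order1 (A, B, r, s) = act1 (of_int A) (of_int B) (of_int r + of_int s * of_int d / 2) (of_int s / 2)"

text \<open>Evaluation at \<open>W b\<close> in integral coordinates: diagonal entries
  \<open>b1\<close>, \<open>b2\<close> and a block in \<open>(r, s)\<close> of determinant d b3 (b3
  + b4) + f b4^2.\<close>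

fun coords1 :: "int \<times> int \<times> int \<times> int \<Rightarrow> int \<times> int \<times> int \<times> int \<Rightarrow> int \<times> int \<times> int \<times> int" where
  "coords1 (b1, b2, b3, b4) (A, B, r, s) = (A * b1, B * b2, r * b3 - s * f * b4, r * b4 + s * d * (b3 + b4))"

fun order2 :: "int \<times> int \<times> int \<times> int \<Rightarrow> complex \<Rightarrow> complex" where
  "order2 (A, r, p, q) = act2 (of_int A) (of_int (p + 2 * r)) (of_int p) (of_int q)"

text \<open>The second and fourth coordinates form a block in \<open>(p, q)\<close> of determinant 2
  d b2^2 + g b4^2; \<open>r\<close> enters only the third, with factor
  \<open>2 * b3 + b4\<close>.\<close>

fun coords2 :: "int \<times> int \<times> int \<times> int \<Rightarrow> int \<times> int \<times> int \<times> int \<Rightarrow> int \<times> int \<times> int \<times> int" where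
  "coords2 (b1, b2, b3, b4) (A, r, p, q) =
    (A * b1, p * b2 - q * g * b4, r * (2 * b3 + b4) + p * b3 - q * d * b2, 2 * q * d * b2 + p * b4)"

fun order3 :: "int \<times> int \<times> int \<times> int \<Rightarrow> complex \<Rightarrow> complex" where
  "order3 (A, r, p, q) = act3 (of_int A) (of_int (p + 2 * r)) (of_int p) (of_int q)"

text \<open>In twice the third plus the fourth coordinate \<open>r\<close> cancels. With the second
  coordinate this gives a block in \<open>(p, q)\<close> of determinant 2 m' b2^2 + g (2 b3 +
  b4)^2.\<close>

fun coords3 :: "int \<times> int \<times> int \<times> int \<Rightarrow> int \<times> int \<times> int \<times> int \<Rightarrow> int \<times> int \<times> int \<times> int" where
  "coords3 (b1, b2, b3, b4) (A, r, p, q) =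
    (A * b1, p * b2 - q * g * (2 * b3 + b4), p * b3 + q * m' * b2 - r * b4, p * b4 + 2 * r * b4)"

lemma order1_W: "order1 t (W b) = W (coords1 b t)"
  by (cases t; cases b) (simp add: act1_def V_eq_iff m'_rat field_simps)

lemma order2_W: "order2 t (W b) = W (coords2 b t)"
  by (cases t; cases b) (simp add: act2_def V_eq_iff field_simps)

lemma order3_W: "order3 t (W b) = W (coords3 b t)"
  by (cases t; cases b) (simp add: act3_def V_eq_iff field_simps)

section \<open>The associated orders\<close>

lemma W_basis: "W (1, 0, 0, 0) = V 1 0 0 0" "W (0, 1, 0, 0) = V 0 1 0 0" "W (0, 0, 1, 0) = V 0 0 1 0"
  "W (0, 0, 0, 1) = V 0 0 (1 / 2) (1 / 2)"
  by simp_all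

text \<open>The image of \<open>rn\<close> shows p - q d and 2 q d to be integral, that of
  \<open>(rn + rk) / 2\<close> shows 2 q f; since \<open>d\<close> and \<open>f\<close> are coprime,
  2 q is integral.\<close>

lemma associated_order1:
  assumes H: "hopf_galois_at L rm H"
  shows "associated_order L H = range order1"
proof (rule associated_order_eq_range[OF ring_of_integers_eq])
  show "order1 t (W b) = W (coords1 b t)" for t b by (rule order1_W)
  show "order1 t \<in> H" for t
    unfolding hopf1[OF H] by (cases t) auto
  fix h assume "h \<in> H" and int: "\<And>b. h (W b) \<in> range W"
  then obtain A B p q where h: "h = act1 A B p q"
    unfolding hopf1[OF H] by blast
  have hV: "h (V a b c e) = V (A * a) (B * b) (p * c - q * of_int m' * e) (q * of_int d * c + p * e)" for a b c e
    unfolding h act1_def by (rule M.linmap_elt)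
  \<comment> \<open>Four facts per basis element, in the order of \<open>V_in_range_W\<close>;
    \<open>int(16)\<close> is the difference of the \<open>rn\<close> and \<open>rk\<close>
    coordinates of the image of \<open>(rn + rk) / 2\<close>.\<close>
  note int = V_in_range_W[OF int[of "(1, 0, 0, 0)", unfolded W_basis hV]]
    V_in_range_W[OF int[of "(0, 1, 0, 0)", unfolded W_basis hV]]
    V_in_range_W[OF int[of "(0, 0, 1, 0)", unfolded W_basis hV]]
    V_in_range_W[OF int[of "(0, 0, 0, 1)", unfolded W_basis hV]]
  have A: "A \<in> \<int>" "B \<in> \<int>" "p - q * of_int d \<in> \<int>" "2 * q * of_int d \<in> \<int>"
    using int by (simp_all add: mult.assoc)
  have "- (p * (1 / 2) - q * of_int m' * (1 / 2) - (q * of_int d * (1 / 2) + p * (1 / 2))) = 2 * q * of_int f"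
    by (simp add: m'_rat field_simps)
  then have "2 * q * of_int f \<in> \<int>"
    using int(16) by (metis Ints_minus)
  moreover have "coprime d f"
  proof (rule coprimeI)
    fix c assume "c dvd d" "c dvd f"
    then have "c dvd 4 * f - d" by simp
    then have "c dvd m'" by (simp flip: f)
    with \<open>c dvd d\<close> show "is_unit c" using coprime(1) by (meson coprime_common_divisor)
  qed
  ultimately have "2 * q \<in> \<int>"
    using A(4) Ints_if_coprime_multiples[of d f "2 * q"] by simp
  then obtain A' B' r s where i: "A = of_int A'" "B = of_int B'" "p - q * of_int d = of_int r" "2 * q = of_int s"
    using A by (auto elim!: Ints_cases)
  then have "q = of_int s / 2" "p = of_int r + of_int s * of_int d / 2" by (simp_all add: field_simps)
  then have "h = order1 (A', B', r, s)"
    unfolding h i order1.simps by (simp only:)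
  then show "h \<in> range order1" by blast
qed

text \<open>The image of \<open>rm\<close> yields p and q d, that of \<open>(rn + rk) / 2\<close>
  yields q g and (B - p) / 2; \<open>d\<close> and \<open>g\<close> are coprime.\<close>

lemma associated_order2:
  assumes H: "hopf_galois_at L rn H"
  shows "associated_order L H = range order2"
proof (rule associated_order_eq_range[OF ring_of_integers_eq])
  show "order2 t (W b) = W (coords2 b t)" for t b by (rule order2_W)
  show "order2 t \<in> H" for t
    unfolding hopf2[OF H] by (cases t) auto
  fix h assume "h \<in> H" and int: "\<And>b. h (W b) \<in> range W"
  then obtain A B p q where h: "h = act2 A B p q"
    unfolding hopf2[OF H] by blast
  have hV: "h (V a b c e) = V (A * a) (p * b - q * of_int (2 * g) * e) (B * c) (q * of_int d * b + p * e)" for a b c e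
    unfolding h act2_def by (rule M.linmap_elt)
  note int = V_in_range_W[OF int[of "(1, 0, 0, 0)", unfolded W_basis hV]]
    V_in_range_W[OF int[of "(0, 1, 0, 0)", unfolded W_basis hV]]
    V_in_range_W[OF int[of "(0, 0, 1, 0)", unfolded W_basis hV]]
    V_in_range_W[OF int[of "(0, 0, 0, 1)", unfolded W_basis hV]]
  have A: "A \<in> \<int>" "p \<in> \<int>" "q * of_int d \<in> \<int>" "q * of_int g \<in> \<int>"
    using int by simp_all
  have "(B - p) / 2 \<in> \<int>"
    using int(16) by (simp add: diff_divide_distrib)
  moreover have "q \<in> \<int>"
    by (rule Ints_if_coprime_multiples[OF coprime(2) A(3,4)])
  ultimately obtain A' p' q' r where i: "A = of_int A'" "p = of_int p'" "q = of_int q'" "(B - p) / 2 = of_int r"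
    using A by (auto elim!: Ints_cases)
  then have "B = of_int (p' + 2 * r)" by (simp add: field_simps)
  then have "h = order2 (A', r, p', q')"
    unfolding h i order2.simps by (simp only:)
  then show "h \<in> range order2" by blast
qed

text \<open>As for \<open>associated_order2\<close>, now with q m' and q g integral and
  \<open>m'\<close>, \<open>g\<close> coprime.\<close>

lemma associated_order3:
  assumes H: "hopf_galois_at L rk H"
  shows "associated_order L H = range order3"
proof (rule associated_order_eq_range[OF ring_of_integers_eq])
  show "order3 t (W b) = W (coords3 b t)" for t b by (rule order3_W)
  show "order3 t \<in> H" for t
    unfolding hopf3[OF H] by (cases t) auto
  fix h assume "h \<in> H" and int: "\<And>b. h (W b) \<in> range W"
  then obtain A B p q where h: "h = act3 A B p q"
    unfolding hopf3[OF H] by blast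
  have hV: "h (V a b c e) = V (A * a) (p * b - q * of_int (2 * g) * c) (q * of_int m' * b + p * c) (B * e)" for a b c e
    unfolding h act3_def by (rule M.linmap_elt)
  note int = V_in_range_W[OF int[of "(1, 0, 0, 0)", unfolded W_basis hV]]
    V_in_range_W[OF int[of "(0, 1, 0, 0)", unfolded W_basis hV]]
    V_in_range_W[OF int[of "(0, 0, 1, 0)", unfolded W_basis hV]]
    V_in_range_W[OF int[of "(0, 0, 0, 1)", unfolded W_basis hV]]
  have A: "A \<in> \<int>" "p \<in> \<int>" "q * of_int m' \<in> \<int>" "q * of_int g \<in> \<int>"
    using int by simp_all
  have "(B - p) / 2 = - (0 * of_int m' + p * (1 / 2) - B * (1 / 2))"
    by (simp add: field_simps)
  then have "(B - p) / 2 \<in> \<int>"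
    using int(16) by (metis Ints_minus mult_zero_left mult_zero_right)
  moreover have "q \<in> \<int>"
    by (rule Ints_if_coprime_multiples[OF coprime(3) A(3,4)])
  ultimately obtain A' p' q' r where i: "A = of_int A'" "p = of_int p'" "q = of_int q'" "(B - p) / 2 = of_int r"
    using A by (auto elim!: Ints_cases)
  then have "B = of_int (p' + 2 * r)" by (simp add: field_simps)
  then have "h = order3 (A', r, p', q')"
    unfolding h i order3.simps by (simp only:)
  then show "h \<in> range order3" by blast
qed

section \<open>Freeness forces the norm equations\<close>

lemma free1_necessary:
  assumes H: "hopf_galois_at L rm H" and "integers_free L H"
  shows "\<exists>x y. x ^ 2 + d * m' * y ^ 2 = 4 * d \<or> x ^ 2 + d * m' * y ^ 2 = - (4 * d)"
proof -
  obtain b where "surj (coords1 b)"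
    using assms(2) free_generator_imp_surj[OF _ ring_of_integers_eq associated_order1[OF H] order1_W inj_W]
    unfolding integers_free_def by blast
  moreover obtain b1 b2 b3 b4 where b: "b = (b1, b2, b3, b4)" by (cases b)
  ultimately have surj: "\<exists>t. coords1 (b1, b2, b3, b4) t = u" for u
    by (metis surjD)
  have "\<exists>r s. b3 * r + (- (f * b4)) * s = u \<and> b4 * r + (d * (b3 + b4)) * s = v" for u v
  proof -
    obtain A B r s where "coords1 (b1, b2, b3, b4) (A, B, r, s) = (0, 0, u, v)"
      using surj by (metis prod_cases4)
    then show ?thesis by (intro exI[of _ r] exI[of _ s]) (auto simp: algebra_simps)
  qed
  from unit_det_if_surj[OF this]
  obtain \<epsilon> where \<epsilon>: "\<epsilon> = 1 \<or> \<epsilon> = - 1" "b3 * (d * (b3 + b4)) - - (f * b4) * b4 = \<epsilon>" by blast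
  \<comment> \<open>Completing the square: 4 d times the determinant is x^2 + m y^2 with x = d (2 b3
    + b4) and y = b4, where d + m' = 4 f makes the last term a multiple of 4 d.\<close>
  have "(2 * d * b3 + d * b4) ^ 2 + d * m' * b4 ^ 2 =
      4 * d * (d * b3 * (b3 + b4)) + d * (d + m') * b4 ^ 2"
    by (simp add: power2_eq_square algebra_simps)
  also have "\<dots> = 4 * d * \<epsilon>"
    unfolding \<epsilon>(2)[symmetric] f by (simp add: power2_eq_square algebra_simps)
  finally show ?thesis using \<epsilon>(1) by (intro exI[of _ "2 * d * b3 + d * b4"] exI[of _ b4]) auto
qed

lemma free2_necessary:
  assumes H: "hopf_galois_at L rn H" and "integers_free L H"
  shows "\<exists>x y. x ^ 2 + 2 * d * g * y ^ 2 = 2 * d \<or> x ^ 2 + 2 * d * g * y ^ 2 = - (2 * d)"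
proof -
  obtain b where "surj (coords2 b)"
    using assms(2) free_generator_imp_surj[OF _ ring_of_integers_eq associated_order2[OF H] order2_W inj_W]
    unfolding integers_free_def by blast
  moreover obtain b1 b2 b3 b4 where b: "b = (b1, b2, b3, b4)" by (cases b)
  ultimately have surj: "\<exists>t. coords2 (b1, b2, b3, b4) t = u" for u
    by (metis surjD)
  have "\<exists>p q. b2 * p + (- (g * b4)) * q = u \<and> b4 * p + (2 * d * b2) * q = v" for u v
  proof -
    \<comment> \<open>The second and fourth coordinates involve \<open>p\<close> and
      \<open>q\<close> alone.\<close>
    obtain A r p q where "coords2 (b1, b2, b3, b4) (A, r, p, q) = (0, u, 0, v)"
      using surj by (metis prod_cases4)
    then show ?thesis by (intro exI[of _ p] exI[of _ q]) (auto simp: algebra_simps)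
  qed
  from unit_det_if_surj[OF this]
  obtain \<epsilon> where \<epsilon>: "\<epsilon> = 1 \<or> \<epsilon> = - 1" "b2 * (2 * d * b2) - - (g * b4) * b4 = \<epsilon>" by blast
  \<comment> \<open>Scaling the determinant by 2 d makes its first term a square.\<close>
  have "(2 * d * b2) ^ 2 + 2 * d * g * b4 ^ 2 = 2 * d * \<epsilon>"
    unfolding \<epsilon>(2)[symmetric] by (simp add: power2_eq_square algebra_simps)
  then show ?thesis using \<epsilon>(1) by (intro exI[of _ "2 * d * b2"] exI[of _ b4]) auto
qed

lemma free3_necessary:
  assumes H: "hopf_galois_at L rk H" and "integers_free L H"
  shows "\<exists>x y. x ^ 2 + 2 * m' * g * y ^ 2 = 2 * (2 * g) \<or> x ^ 2 + 2 * m' * g * y ^ 2 = - (2 * (2 * g))"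
proof -
  obtain b where "surj (coords3 b)"
    using assms(2) free_generator_imp_surj[OF _ ring_of_integers_eq associated_order3[OF H] order3_W inj_W]
    unfolding integers_free_def by blast
  moreover obtain b1 b2 b3 b4 where b: "b = (b1, b2, b3, b4)" by (cases b)
  ultimately have surj: "\<exists>t. coords3 (b1, b2, b3, b4) t = u" for u
    by (metis surjD)
  define w where "w = 2 * b3 + b4"
  have "\<exists>p q. b2 * p + (- (g * w)) * q = u \<and> w * p + (2 * m' * b2) * q = v" for u v
  proof -
    obtain A r p q where "coords3 (b1, b2, b3, b4) (A, r, p, q) = (0, u, 0, v)"
      using surj by (metis prod_cases4)
    then have eq: "p * b2 - q * g * w = u" "p * b3 + q * m' * b2 - r * b4 = 0" "p * b4 + 2 * r * b4 = v"
      by (auto simp: w_def)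
    \<comment> \<open>This combination of the third and fourth coordinates eliminates
      \<open>r\<close>.\<close>
    have "w * p + (2 * m' * b2) * q =
        2 * (p * b3 + q * m' * b2 - r * b4) + (p * b4 + 2 * r * b4)"
      by (simp add: w_def algebra_simps)
    then have "w * p + (2 * m' * b2) * q = v" using eq by simp
    moreover have "b2 * p + (- (g * w)) * q = u"
      unfolding eq(1)[symmetric] by (simp add: algebra_simps)
    ultimately show ?thesis by blast
  qed
  from unit_det_if_surj[OF this]
  obtain \<epsilon> where \<epsilon>: "\<epsilon> = 1 \<or> \<epsilon> = - 1" "b2 * (2 * m' * b2) - - (g * w) * w = \<epsilon>" by blast
  \<comment> \<open>Scaling the determinant by 4 g makes its second term the square of 2 g
    w.\<close>
  have "(2 * g * w) ^ 2 + 2 * m' * g * (2 * b2) ^ 2 = 2 * (2 * g) * \<epsilon>"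
    unfolding \<epsilon>(2)[symmetric] by (simp add: power2_eq_square algebra_simps)
  then show ?thesis using \<epsilon>(1) by (intro exI[of _ "2 * g * w"] exI[of _ "2 * b2"]) auto
qed

section \<open>Explicit generators from solutions\<close>

text \<open>The completion of the square is reversed: \<open>d\<close> divides \<open>x\<close>, and
  \<open>X = x / d\<close> has the parity of \<open>y\<close>. So z = (x - d y) / (2 d) is an
  integer, and the block at \<open>(1, 1, z, y)\<close> has determinant \<epsilon>.\<close>

lemma free1_generator:
  assumes H: "hopf_galois_at L rm H"
    and xy: "x ^ 2 + d * m' * y ^ 2 = 4 * d \<or> x ^ 2 + d * m' * y ^ 2 = - (4 * d)"
  shows "free_generator L H
    (1 + rm + (of_int x - of_int d * of_int y) / (2 * of_int d) * rn + of_int y * ((rn + rk) / 2))"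
proof -
  obtain \<epsilon> where \<epsilon>: "\<epsilon> = 1 \<or> \<epsilon> = - 1" "x * x + d * m' * (y * y) = \<epsilon> * (4 * d)"
    using eq_sign_mult[OF xy] unfolding power2_eq_square by blast
  have "x * x = d * (4 * \<epsilon> - m' * (y * y))"
    using \<epsilon>(2) by (simp add: algebra_simps)
  then have "d dvd x"
    using squarefree_dvd_square[of d x] squarefree_multD(1)[OF sqfree(1)] by simp
  then obtain X where X: "x = d * X" by (rule dvdE)
  have "d * (d * (X * X) + m' * (y * y)) = d * (4 * \<epsilon>)"
    using \<epsilon>(2) unfolding X by (simp add: algebra_simps)
  then have eq: "d * (X * X) + m' * (y * y) = 4 * \<epsilon>" using d by simp
  then have "even (d * (X * X) + m' * (y * y))" by simp
  then have "even (X - y)" using d odd_m' by auto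
  then obtain z where z: "X = y + 2 * z" by (metis diff_eq_eq add.commute evenE)
  have "4 * (z * (d * (z + y)) - - (f * y) * y) = d * (X * X) + (4 * f - d) * (y * y)"
    unfolding z by (simp add: algebra_simps)
  also have "\<dots> = 4 * \<epsilon>"
    using eq f by (metis add_diff_cancel_left')
  finally have det: "z * (d * (z + y)) - - (f * y) * y = 1 \<or> z * (d * (z + y)) - - (f * y) * y = - 1"
    using \<epsilon>(1) by auto
  have "bij (coords1 (1, 1, z, y))"
  proof (rule bijI)
    show "inj (coords1 (1, 1, z, y))"
    proof (rule injI)
      fix t u assume eq: "coords1 (1, 1, z, y) t = coords1 (1, 1, z, y) u"
      obtain A B r s where t: "t = (A, B, r, s)" by (cases t)
      obtain A' B' r' s' where u: "u = (A', B', r', s')" by (cases u)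
      have eqs: "A = A'" "B = B'" "r * z - s * f * y = r' * z - s' * f * y"
        "r * y + s * d * (z + y) = r' * y + s' * d * (z + y)"
        using eq unfolding t u by simp_all
      have "z * r + - (f * y) * s = z * r' + - (f * y) * s'"
        using eqs(3) by (simp add: mult_ac)
      moreover have "y * r + d * (z + y) * s = y * r' + d * (z + y) * s'"
        using eqs(4) by (simp only: mult_ac)
      ultimately have "r = r' \<and> s = s'"
        using unit_det_imp_inj[OF det] by blast
      then show "t = u" using eqs(1,2) unfolding t u by simp
    qed
    show "surj (coords1 (1, 1, z, y))"
      unfolding surj_def
    proof (intro allI)
      fix u :: "int \<times> int \<times> int \<times> int"
      obtain u1 u2 u3 u4 where u: "u = (u1, u2, u3, u4)" by (cases u)
      obtain r s where "z * r + - (f * y) * s = u3" "y * r + d * (z + y) * s = u4"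
        using unit_det_imp_surj[OF det] by blast
      then have "u = coords1 (1, 1, z, y) (u1, u2, r, s)"
        unfolding u by (simp add: mult_ac)
      then show "\<exists>t. u = coords1 (1, 1, z, y) t" ..
    qed
  qed
  then have "free_generator L H (W (1, 1, z, y))"
    by (rule free_generator_if_bij[OF ring_of_integers_eq associated_order1[OF H] order1_W inj_W])
  moreover have "x - d * y = z * (2 * d)"
    unfolding X z by (simp add: algebra_simps)
  then have "of_int x - of_int d * of_int y = (of_int z * (2 * of_int d) :: complex)"
    by (metis of_int_diff of_int_mult of_int_numeral)
  then have "(of_int x - of_int d * of_int y) / (2 * of_int d) = (of_int z :: complex)"
    using d by (metis mult_eq_0_iff nonzero_mult_div_cancel_right of_int_eq_0_iff order_less_irrefl zero_neq_numeral)
  ultimately show ?thesis unfolding W_eq by simp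
qed

text \<open>As \<open>2 * d\<close> is squarefree it divides \<open>x\<close>, and dividing the
  equation by it leaves the unimodular determinant, which also forces \<open>y\<close> to be
  odd.\<close>

lemma free2_generator:
  assumes H: "hopf_galois_at L rn H"
    and xy: "x ^ 2 + 2 * d * g * y ^ 2 = 2 * d \<or> x ^ 2 + 2 * d * g * y ^ 2 = - (2 * d)"
  shows "free_generator L H
    (1 + of_int x / (2 * of_int d) * rm + (1 - of_int y) / 2 * rn + of_int y * ((rn + rk) / 2))"
proof -
  obtain \<epsilon> where \<epsilon>: "\<epsilon> = 1 \<or> \<epsilon> = - 1" "x * x + 2 * d * g * (y * y) = \<epsilon> * (2 * d)"
    using eq_sign_mult[OF xy] unfolding power2_eq_square by blast
  have x2: "x * x = (2 * d) * (\<epsilon> - g * (y * y))"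
    using \<epsilon>(2) by (simp add: algebra_simps)
  have "squarefree (2 * d)"
    using squarefree_multD(1)[OF sqfree(2)] .
  then have "2 * d dvd x"
    using x2 squarefree_dvd_square[of "2 * d" x] by simp
  then obtain z where x: "x = 2 * d * z" by (rule dvdE)
  have "2 * d * (2 * d * (z * z) + g * (y * y)) = 2 * d * \<epsilon>"
    using \<epsilon>(2) unfolding x by (simp add: algebra_simps)
  then have eq: "2 * d * (z * z) + g * (y * y) = \<epsilon>" using d by simp
  then have det: "z * (2 * d * z) - - (g * y) * y = 1 \<or> z * (2 * d * z) - - (g * y) * y = - 1"
    using \<epsilon>(1) by (simp add: algebra_simps)
  have "odd (2 * d * (z * z) + g * (y * y))" using eq \<epsilon>(1) by auto
  then have "odd y" by auto
  then have "even (1 - y)" by simp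
  \<comment> \<open>This coefficient of \<open>rn\<close> makes 2 y' + y = 1, the factor with which
    \<open>r\<close> enters the third coordinate.\<close>
  then obtain y' where "1 - y = 2 * y'" by (rule evenE)
  then have y': "y = 1 - 2 * y'" by simp
  have "bij (coords2 (1, z, y', y))"
  proof (rule bijI)
    show "inj (coords2 (1, z, y', y))"
    proof (rule injI)
      fix t u assume eq: "coords2 (1, z, y', y) t = coords2 (1, z, y', y) u"
      obtain A r p q where t: "t = (A, r, p, q)" by (cases t)
      obtain A' r' p' q' where u: "u = (A', r', p', q')" by (cases u)
      have eqs: "A = A'" "p * z - q * g * y = p' * z - q' * g * y"
        "r * (2 * y' + y) + p * y' - q * d * z = r' * (2 * y' + y) + p' * y' - q' * d * z"
        "2 * q * d * z + p * y = 2 * q' * d * z + p' * y"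
        using eq unfolding t u by simp_all
      have "z * p + - (g * y) * q = z * p' + - (g * y) * q'"
        using eqs(2) by (simp add: mult_ac)
      moreover have "y * p + 2 * d * z * q = y * p' + 2 * d * z * q'"
        using eqs(4) by (simp only: mult_ac add_ac)
      ultimately have "p = p' \<and> q = q'"
        using unit_det_imp_inj[OF det] by blast
      moreover have "2 * y' + y = 1" by (simp add: y')
      ultimately show "t = u" using eqs(1,3) unfolding t u by simp
    qed
    show "surj (coords2 (1, z, y', y))"
      unfolding surj_def
    proof (intro allI)
      fix u :: "int \<times> int \<times> int \<times> int"
      obtain u1 u2 u3 u4 where u: "u = (u1, u2, u3, u4)" by (cases u)
      obtain p q where "z * p + - (g * y) * q = u2" "y * p + 2 * d * z * q = u4"
        using unit_det_imp_surj[OF det] by blast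
      \<comment> \<open>With \<open>p\<close> and \<open>q\<close> fixed by the block, the third
        coordinate is solved for \<open>r\<close>.\<close>
      then have "u = coords2 (1, z, y', y) (u1, u3 - p * y' + q * d * z, p, q)"
        unfolding u by (simp add: y' mult_ac)
      then show "\<exists>t. u = coords2 (1, z, y', y) t" ..
    qed
  qed
  then have "free_generator L H (W (1, z, y', y))"
    by (rule free_generator_if_bij[OF ring_of_integers_eq associated_order2[OF H] order2_W inj_W])
  moreover have "of_int x / (2 * of_int d) = (of_int z :: complex)"
    using d unfolding x by simp
  moreover have "(1 - of_int y) / 2 = (of_int y' :: complex)"
    unfolding y' by simp
  ultimately show ?thesis unfolding W_eq by simp
qed

text \<open>Since \<open>2 * g\<close> is squarefree, x = 2 g w. Parity gives first y = 2 z and then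
  \<open>w\<close> odd; v = (w - 1) / 2 makes 2 b3 + b4 equal to \<open>w\<close> while b4 = 1 keeps
  the factor of \<open>r\<close> a unit.\<close>

lemma free3_generator:
  assumes H: "hopf_galois_at L rk H"
    and xy: "x ^ 2 + 2 * m' * g * y ^ 2 = 2 * (2 * g) \<or> x ^ 2 + 2 * m' * g * y ^ 2 = - (2 * (2 * g))"
  shows "free_generator L H
    (1 + of_int y / 2 * rm + (of_int x * of_int d - of_int (2 * d * g)) / (2 * of_int (2 * d * g)) * rn
      + (rn + rk) / 2)"
proof -
  obtain \<epsilon> where \<epsilon>: "\<epsilon> = 1 \<or> \<epsilon> = - 1" "x * x + 2 * m' * g * (y * y) = \<epsilon> * (2 * (2 * g))"
    using eq_sign_mult[OF xy] unfolding power2_eq_square by blast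
  have g0: "g \<noteq> 0" using g by auto
  have x2: "x * x = (2 * g) * (2 * \<epsilon> - m' * (y * y))"
    using \<epsilon>(2) by (simp add: algebra_simps)
  have "squarefree (2 * g)"
    using squarefree_mono[OF _ sqfree(2), of "2 * g"] by simp
  then have "2 * g dvd x"
    using x2 squarefree_dvd_square[of "2 * g" x] by simp
  then obtain w where x: "x = 2 * g * w" by (rule dvdE)
  have "2 * g * (2 * g * (w * w) + m' * (y * y)) = 2 * g * (2 * \<epsilon>)"
    using \<epsilon>(2) unfolding x by (simp add: algebra_simps)
  then have eq: "2 * g * (w * w) + m' * (y * y) = 2 * \<epsilon>" using g0 by simp
  then have "even (2 * g * (w * w) + m' * (y * y))" by simp
  then have "even y" using odd_m' by auto
  then obtain z where z: "y = 2 * z" by (rule evenE)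
  have eq2: "g * (w * w) + 2 * m' * (z * z) = \<epsilon>"
    using eq unfolding z by simp
  then have det: "z * (2 * m' * z) - - (g * w) * w = 1 \<or> z * (2 * m' * z) - - (g * w) * w = - 1"
    using \<epsilon>(1) by (simp add: algebra_simps)
  have "odd (g * (w * w) + 2 * m' * (z * z))" using eq2 \<epsilon>(1) by auto
  then have "odd w" by auto
  then obtain v where w: "w = 2 * v + 1" by (rule oddE)
  have "bij (coords3 (1, z, v, 1))"
  proof (rule bijI)
    show "inj (coords3 (1, z, v, 1))"
    proof (rule injI)
      fix t u assume eq: "coords3 (1, z, v, 1) t = coords3 (1, z, v, 1) u"
      obtain A r p q where t: "t = (A, r, p, q)" by (cases t)
      obtain A' r' p' q' where u: "u = (A', r', p', q')" by (cases u)
      have eqs: "A = A'" "p * z - q * g * w = p' * z - q' * g * w"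
        "p * v + q * m' * z - r = p' * v + q' * m' * z - r'" "p + 2 * r = p' + 2 * r'"
        using eq unfolding t u by (auto simp: w)
      have "w * p + 2 * m' * z * q = 2 * (p * v + q * m' * z - r) + (p + 2 * r)" for p q r
        by (simp add: w algebra_simps)
      then have "w * p + 2 * m' * z * q = w * p' + 2 * m' * z * q'"
        using eqs(3,4) by metis
      moreover have "z * p + - (g * w) * q = z * p' + - (g * w) * q'"
        using eqs(2) by (simp add: mult_ac)
      ultimately have "p = p' \<and> q = q'"
        using unit_det_imp_inj[OF det] by blast
      then show "t = u" using eqs unfolding t u by simp
    qed
    show "surj (coords3 (1, z, v, 1))"
      unfolding surj_def
    proof (intro allI)
      fix u :: "int \<times> int \<times> int \<times> int"
      obtain u1 u2 u3 u4 where u: "u = (u1, u2, u3, u4)" by (cases u)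
      \<comment> \<open>The target \<open>u4 + 2 * u3\<close> belongs to the combination free of
        \<open>r\<close>; the third coordinate then determines \<open>r\<close>.\<close>
      obtain p q where pq: "z * p + - (g * w) * q = u2" "w * p + 2 * m' * z * q = u4 + 2 * u3"
        using unit_det_imp_surj[OF det] by blast
      have "u4 = p + 2 * (p * v + q * m' * z - u3)"
        using pq(2) by (simp add: w algebra_simps)
      then have "u = coords3 (1, z, v, 1) (u1, p * v + q * m' * z - u3, p, q)"
        unfolding u pq(1)[symmetric] w by (simp add: mult_ac)
      then show "\<exists>t. u = coords3 (1, z, v, 1) t" ..
    qed
  qed
  then have "free_generator L H (W (1, z, v, 1))"
    by (rule free_generator_if_bij[OF ring_of_integers_eq associated_order3[OF H] order3_W inj_W])
  \<comment> \<open>This identifies \<open>v\<close> with the coefficient (x d - n) / (2 n).\<close>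
  moreover have "x * d - 2 * d * g = v * (2 * (2 * d * g))"
    unfolding x w by (simp add: algebra_simps)
  then have "of_int x * of_int d - of_int (2 * d * g) = (of_int v * (2 * of_int (2 * d * g)) :: complex)"
    by (metis of_int_diff of_int_mult of_int_numeral)
  then have "(of_int x * of_int d - of_int (2 * d * g)) / (2 * of_int (2 * d * g)) = (of_int v :: complex)"
    using d g0 by (metis mult_eq_0_iff nonzero_mult_div_cancel_right of_int_eq_0_iff order_less_irrefl zero_neq_numeral)
  moreover have "of_int y / 2 = (of_int z :: complex)"
    unfolding z by simp
  ultimately show ?thesis unfolding W_eq by simp
qed

end

section \<open>From the stated hypotheses to the parametrised setting\<close>

lemma squarefree_mult_imp_coprime:
  fixes a b :: int
  assumes "squarefree (a * b)"
  shows "coprime a b"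
proof (rule coprimeI)
  fix c assume "c dvd a" "c dvd b"
  then have "c ^ 2 dvd a * b" by (simp add: power2_eq_square mult_dvd_mono)
  then show "is_unit c" using assms by (rule squarefreeD[rotated])
qed

lemma biquadratic_field_gcd:
  fixes m n :: int and rm rn :: complex
  defines "d \<equiv> gcd m n"
  assumes sq: "squarefree m" "squarefree n" and mods: "[m = 3] (mod 4)" "[n = 2] (mod 4)"
    and roots: "rm ^ 2 = of_int m" "rn ^ 2 = of_int n"
  obtains m' g f where "m = d * m'" "n = 2 * d * g" "biquadratic_field d m' g f rm rn (rm * rn / of_int d)"
proof -
  have m: "m mod 4 = 3" and n: "n mod 4 = 2"
    using mods by (simp_all add: cong_def)
  then have odd_m: "odd m" and n2: "even n" "\<not> 4 dvd n"
    by presburger+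
  obtain m' where m': "m = d * m'"
    unfolding d_def by (meson dvdE gcd_dvd1)
  obtain n' where n': "n = d * n'"
    unfolding d_def by (meson dvdE gcd_dvd2)
  have "0 < d"
    using odd_m unfolding d_def gcd_pos_int by auto
  moreover have "odd d"
    using odd_m unfolding m' by simp
  ultimately have d: "0 < d" "odd d" .
  then have "even n'"
    using n2 n' by simp
  then obtain g where g: "n' = 2 * g" by (rule evenE)
  have "odd g"
  proof
    assume "even g"
    then obtain h where "g = 2 * h" by (rule evenE)
    then have "n = 4 * (d * h)" using n' g by simp
    with n2 show False by simp
  qed
  \<comment> \<open>Modulo 4 the right side is 1 + 3, and the odd factor \<open>d\<close> can be
    cancelled.\<close>
  have "d * (d + m') = d * d + m"
    by (simp add: m' distrib_left)
  then have "4 dvd d * (d + m')"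
    using m square_mod_4[of d] d by presburger
  moreover have "coprime 4 d"
  proof -
    have "coprime (2 * 2) d"
      unfolding coprime_mult_left_iff coprime_left_2_iff_odd using d by blast
    then show ?thesis by simp
  qed
  ultimately have "4 dvd d + m'"
    by (simp add: coprime_dvd_mult_right_iff)
  then obtain f where f: "d + m' = 4 * f" by (rule dvdE)
  have "coprime m' n'"
  proof -
    have "coprime (m div d) (n div d)"
      unfolding d_def using odd_m by (intro div_gcd_coprime) auto
    then show ?thesis using d by (simp add: m' n')
  qed
  have n_eq: "n = 2 * d * g"
    by (simp add: n' g)
  have "biquadratic_field d m' g f rm rn (rm * rn / of_int d)"
  proof
    show "coprime d m'"
      using sq(1) unfolding m' by (rule squarefree_mult_imp_coprime)
    have "coprime d n'"
      using sq(2) unfolding n' by (rule squarefree_mult_imp_coprime)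
    then show "coprime d g" by (simp add: g)
    show "coprime m' g"
      using \<open>coprime m' n'\<close> by (simp add: g)
    \<comment> \<open>The radicand of \<open>rk\<close> is a product of coprime divisors of the
      squarefree numbers \<open>m\<close> and \<open>n\<close>.\<close>
    have "squarefree (m' * n')"
      using \<open>coprime m' n'\<close> squarefree_mono[OF _ sq(1), of m'] squarefree_mono[OF _ sq(2), of n']
      by (intro squarefree_mult_coprime) (simp_all add: m' n')
    then show "squarefree (2 * m' * g)" by (simp add: g mult_ac)
    show "rm * rm = of_int (d * m')" "rn * rn = of_int (2 * d * g)"
      using roots unfolding power2_eq_square m'[symmetric] n_eq[symmetric] .
    show "squarefree (d * m')" "squarefree (2 * d * g)"
      using sq unfolding m'[symmetric] n_eq[symmetric] .
  qed (use d f \<open>odd g\<close> in simp_all)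
  with m' n_eq show ?thesis by (rule that)
qed

theorem proposition5p2:
  fixes m n d k :: int
    and rm rn rk :: complex
    and L :: "complex set"
    and H1 H2 H3 :: "(complex \<Rightarrow> complex) set"
    and \<gamma>1 \<gamma>2 \<gamma>3 \<gamma>4 :: complex
  assumes "squarefree m" and "squarefree n"
    and "[m = 3] (mod 4)" and "[n = 2] (mod 4)"
    and "d = gcd m n" and "k = m * n div d ^ 2"
    and "rm ^ 2 = of_int m" and "rn ^ 2 = of_int n" and "rk = rm * rn / of_int d"
    and "L = rat_adjoin {rm, rn}"
    and "hopf_galois_at L rm H1" and "hopf_galois_at L rn H2" and "hopf_galois_at L rk H3"
    and "\<gamma>1 = 1" and "\<gamma>2 = rm" and "\<gamma>3 = rn" and "\<gamma>4 = (rn + rk) / 2"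
  shows
    "(integers_free L H1 \<longleftrightarrow>
        (\<exists>x y :: int. x ^ 2 + m * y ^ 2 = 4 * d \<or> x ^ 2 + m * y ^ 2 = - (4 * d))) \<and>
     (\<forall>x y :: int. x ^ 2 + m * y ^ 2 = 4 * d \<or> x ^ 2 + m * y ^ 2 = - (4 * d) \<longrightarrow>
        free_generator L H1
          (\<gamma>1 + \<gamma>2 + (of_int x - of_int d * of_int y) / (2 * of_int d) * \<gamma>3 + of_int y * \<gamma>4)) \<and>
     (integers_free L H2 \<longleftrightarrow>
        (\<exists>x y :: int. x ^ 2 + n * y ^ 2 = 2 * d \<or> x ^ 2 + n * y ^ 2 = - (2 * d))) \<and>
     (\<forall>x y :: int. x ^ 2 + n * y ^ 2 = 2 * d \<or> x ^ 2 + n * y ^ 2 = - (2 * d) \<longrightarrow>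
        free_generator L H2
          (\<gamma>1 + of_int x / (2 * of_int d) * \<gamma>2 + (1 - of_int y) / 2 * \<gamma>3 + of_int y * \<gamma>4)) \<and>
     (integers_free L H3 \<longleftrightarrow>
        (\<exists>x y :: int. x ^ 2 + k * y ^ 2 = 2 * (n div d) \<or> x ^ 2 + k * y ^ 2 = - (2 * (n div d)))) \<and>
     (\<forall>x y :: int. x ^ 2 + k * y ^ 2 = 2 * (n div d) \<or> x ^ 2 + k * y ^ 2 = - (2 * (n div d)) \<longrightarrow>
        free_generator L H3
          (\<gamma>1 + of_int y / 2 * \<gamma>2 + (of_int x * of_int d - of_int n) / (2 * of_int n) * \<gamma>3 + \<gamma>4))"
proof -
  obtain m' g f where eqs: "m = d * m'" "n = 2 * d * g" and
    field: "biquadratic_field d m' g f rm rn rk"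
    using biquadratic_field_gcd[OF assms(1-4,7,8)] assms(5,9) by metis
  interpret biquadratic_field d m' g f rm rn rk by (rule field)
  have "m * n = 2 * m' * g * d ^ 2"
    by (simp add: eqs power2_eq_square)
  then have k: "k = 2 * m' * g"
    using d assms(6) by simp
  have n_div: "n div d = 2 * g"
    using d by (simp add: eqs)
  have L: "L = M.field"
    using assms(10) M.rat_adjoin_zeta_xi by simp
  note H = assms(11-13)[unfolded L]
  note \<gamma> = assms(14-17)
  have gen1: "free_generator L H1
      (\<gamma>1 + \<gamma>2 + (of_int x - of_int d * of_int y) / (2 * of_int d) * \<gamma>3 + of_int y * \<gamma>4)"
    if "x ^ 2 + m * y ^ 2 = 4 * d \<or> x ^ 2 + m * y ^ 2 = - (4 * d)" for x y
    unfolding L \<gamma> by (rule free1_generator[OF H(1) that[unfolded eqs(1)]])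
  have gen2: "free_generator L H2
      (\<gamma>1 + of_int x / (2 * of_int d) * \<gamma>2 + (1 - of_int y) / 2 * \<gamma>3 + of_int y * \<gamma>4)"
    if "x ^ 2 + n * y ^ 2 = 2 * d \<or> x ^ 2 + n * y ^ 2 = - (2 * d)" for x y
    unfolding L \<gamma> by (rule free2_generator[OF H(2) that[unfolded eqs(2)]])
  have gen3: "free_generator L H3
      (\<gamma>1 + of_int y / 2 * \<gamma>2 + (of_int x * of_int d - of_int n) / (2 * of_int n) * \<gamma>3 + \<gamma>4)"
    if "x ^ 2 + k * y ^ 2 = 2 * (n div d) \<or> x ^ 2 + k * y ^ 2 = - (2 * (n div d))" for x y
    unfolding L \<gamma> eqs(2) by (rule free3_generator[OF H(3) that[unfolded k n_div]])
  have iff1: "integers_free L H1 \<longleftrightarrow>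
      (\<exists>x y. x ^ 2 + m * y ^ 2 = 4 * d \<or> x ^ 2 + m * y ^ 2 = - (4 * d))"
    using free1_necessary[OF H(1)] gen1 unfolding integers_free_def L eqs(1) by blast
  have iff2: "integers_free L H2 \<longleftrightarrow>
      (\<exists>x y. x ^ 2 + n * y ^ 2 = 2 * d \<or> x ^ 2 + n * y ^ 2 = - (2 * d))"
    using free2_necessary[OF H(2)] gen2 unfolding integers_free_def L eqs(2) by blast
  have iff3: "integers_free L H3 \<longleftrightarrow>
      (\<exists>x y. x ^ 2 + k * y ^ 2 = 2 * (n div d) \<or> x ^ 2 + k * y ^ 2 = - (2 * (n div d)))"
    using free3_necessary[OF H(3)] gen3 unfolding integers_free_def L k n_div by blast
  show ?thesis
    using iff1 gen1 iff2 gen2 iff3 gen3 by blast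
qed

end
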